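(* Consider a linear private information retrieval scheme over a finite field $\mathbb{F}_p$ with $M\ge2$ messages and $S\ge2$ servers, as described in the context, satisfying correctness and privacy. Then the scheme achieves the capacity, i.e. its rate satisfies $$\mathcal{R}=\frac{1-\frac1S}{1-\left(\frac1S\right)^M},$$ if and only if the following two conditions hold (for every realization of the queries of positive probability): (1) for all $j\in[1:S]$ and all $m\in[1:M]$, $\ \operatorname{rank}Q_{1:S}^{(m)}[\bar m]=\operatorname{rank}Q_j^{(m)}[\bar m]$, where $\bar m=[1:M]\setminus\{m\}$; (2) for all $m\in[1:M]$ and all $\bar{\mathcal{I}}\subset[1:M]\setminus\{m\}$, with $\mathcal{I}=[1:M]\setminus\bar{\mathcal{I}}$, $\ \operatorname{rank}Q_{1:S}^{(m)}[\mathcal{I}]=\sum_{j=1}^S\operatorname{rank}Q_j^{(m)}[\mathcal{I}]$.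
   Context: Notation: $[1:Z]=\{1,\dots,Z\}$; $\mathbb{F}_p$ is a finite field of order $p$; entropies $H$ are measured with logarithms to base $p$. Setting: each of $S$ servers stores the same $M$ messages $W_1,\dots,W_M$, column vectors of length $L_w$ over $\mathbb{F}_p$, which are independent with $H(W_1)=\dots=H(W_M)=L_w$ (i.e. independent and uniform on $\mathbb{F}_p^{L_w}$). To retrieve message $W_m$, the user sends randomly generated queries $Q_j^{(m)}$ to the servers $j\in[1:S]$; the queries take finitely many values and are independent of the messages. In a linear scheme, $Q_j^{(m)}=(Q_j^{(m)}[1],\dots,Q_j^{(m)}[M])$ is a matrix over $\mathbb{F}_p$ in which each block $Q_j^{(m)}[k]$ has $L_w$ columns, and server $j$ returns $X_j^{(m)}=\sum_{k=1}^M Q_j^{(m)}[k]W_k$. For $\mathcal{J}\subset[1:M]$, $Q_j^{(m)}[\mathcal{J}]$ is the submatrix consisting of the blocks $Q_j^{(m)}[k]$, $k\in\mathcal{J}$, and $Q_{1:S}^{(m)}[\mathcal{J}]$ is the matrix obtained by stacking $Q_1^{(m)}[\mathcal{J}],\dots,Q_S^{(m)}[\mathcal{J}]$ vertically. $Q_{1:S}^{(m)}$ and $X_{1:S}^{(m)}$ denote all queries and all responses. Correctness: $H(W_m\mid X_{1:S}^{(m)},Q_{1:S}^{(m)})=0$ for all $m\in[1:M]$. Privacy (non-colluding servers): for every $j\in[1:S]$, the distribution of $Q_j^{(m)}$ does not depend on $m\in[1:M]$. Rate: $\displaystyle \mathcal{R}=\min_{m\in[1:M]}\frac{H(W_m)}{\sum_{i=1}^S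 H(X_i^{(m)}\mid Q_i^{(m)})}$. Every scheme with correctness and privacy has $\mathcal{R}\le\frac{1-1/S}{1-(1/S)^M}$, and this upper bound is called the capacity. *)

theory Defs
  imports
    "HOL-Probability.Information"
    "Jordan_Normal_Form.DL_Rank"
    "Jordan_Normal_Form.DL_Submatrix"
begin

text \<open>Messages and servers are numbered from 1. A query is one matrix with \<open>M * L\<close> columns and any
  number of rows; its block \<open>k\<close> consists of the columns \<open>(k - 1) * L, \<dots>, k * L - 1\<close>. The number of
  rows may differ between servers and between realizations of the same query. Entropies are taken
  to base \<open>CARD('a)\<close>, the order of the field \<open>'a\<close>.\<close>

definition query_part :: "nat \<Rightarrow> nat set \<Rightarrow> 'a mat \<Rightarrow> 'a mat" where
  "query_part L J A = submatrix A UNIV (\<Union>k\<in>J. {(k - 1) * L..<k * L})"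

text \<open>The number \<open>n\<close> of columns is passed explicitly, as it cannot be read off an empty list.\<close>

definition stack_rows :: "nat \<Rightarrow> 'a mat list \<Rightarrow> 'a mat" where
  "stack_rows n As = mat_of_rows n (concat (map rows As))"

definition stacked_query_part :: "nat \<Rightarrow> nat \<Rightarrow> nat set \<Rightarrow> (nat \<Rightarrow> 'a mat) \<Rightarrow> 'a mat" where
  "stacked_query_part S L J q =
     stack_rows (card J * L) (map (\<lambda>j. query_part L J (q j)) [1..<Suc S])"

definition mat_rank :: "'a::field mat \<Rightarrow> nat" where
  "mat_rank A = vec_space.rank (dim_row A) A"

definition response :: "nat \<Rightarrow> nat \<Rightarrow> 'a::semiring_0 mat \<Rightarrow> (nat \<Rightarrow> 'a Matrix.vec) \<Rightarrow> 'a Matrix.vec" where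
  "response M L A w =
     finsum_vec TYPE('a) (dim_row A) (\<lambda>k. query_part L {k} A *\<^sub>v w k) {1..M}"

definition entropy_of :: "real \<Rightarrow> 'w measure \<Rightarrow> ('w \<Rightarrow> 'b) \<Rightarrow> real" where
  "entropy_of b \<Omega> X = prob_space.entropy \<Omega> b (count_space (X ` space \<Omega>)) X"

definition cond_entropy_of :: "real \<Rightarrow> 'w measure \<Rightarrow> ('w \<Rightarrow> 'b) \<Rightarrow> ('w \<Rightarrow> 'c) \<Rightarrow> real" where
  "cond_entropy_of b \<Omega> X Y =
     prob_space.conditional_entropy \<Omega> b
       (count_space (X ` space \<Omega>)) (count_space (Y ` space \<Omega>)) X Y"

text \<open>\<open>W k\<close> is message \<open>k\<close>, and \<open>Q m j\<close> is the query sent to server \<open>j\<close> when message \<open>m\<close> is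
  wanted. For each \<open>m\<close> the queries \<open>Q m 1, \<dots>, Q m S\<close> are jointly independent of all the messages;
  nothing is assumed about the joint law of queries for different \<open>m\<close>. Independence is stated with
  \<open>indep_set\<close> because \<open>indep_var\<close> needs both variables to have the same type.\<close>

locale linear_pir_scheme = prob_space \<Omega>
  for \<Omega> :: "'w measure" +
  fixes M S L :: nat
    and W :: "nat \<Rightarrow> 'w \<Rightarrow> 'a::{field,finite} Matrix.vec"
    and Q :: "nat \<Rightarrow> nat \<Rightarrow> 'w \<Rightarrow> 'a mat"
  assumes message_length_pos: "L > 0"
    and messages_independent: "indep_vars (\<lambda>_. count_space (carrier_vec L)) W {1..M}"
    and messages_uniform:
      "\<And>k. k \<in> {1..M} \<Longrightarrow>
         distr \<Omega> (count_space (carrier_vec L)) (W k) = uniform_count_measure (carrier_vec L)"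
    and queries_finite:
      "\<And>m j. m \<in> {1..M} \<Longrightarrow> j \<in> {1..S} \<Longrightarrow> simple_function \<Omega> (Q m j)"
    and queries_columns:
      "\<And>m j \<omega>. m \<in> {1..M} \<Longrightarrow> j \<in> {1..S} \<Longrightarrow> \<omega> \<in> space \<Omega> \<Longrightarrow> dim_col (Q m j \<omega>) = M * L"
    and queries_independent_of_messages:
      "\<And>m. m \<in> {1..M} \<Longrightarrow>
         indep_set
           (range (\<lambda>A. (\<lambda>\<omega>. \<lambda>j\<in>{1..S}. Q m j \<omega>) -` A \<inter> space \<Omega>))
           (range (\<lambda>B. (\<lambda>\<omega>. \<lambda>k\<in>{1..M}. W k \<omega>) -` B \<inter> space \<Omega>))"

definition pir_response ::
  "nat \<Rightarrow> nat \<Rightarrow> (nat \<Rightarrow> 'w \<Rightarrow> 'a::semiring_0 Matrix.vec) \<Rightarrow> (nat \<Rightarrow> nat \<Rightarrow> 'w \<Rightarrow> 'a mat) \<Rightarrow>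
    nat \<Rightarrow> nat \<Rightarrow> 'w \<Rightarrow> 'a Matrix.vec" where
  "pir_response M L W Q m j \<omega> = response M L (Q m j \<omega>) (\<lambda>k. W k \<omega>)"

definition pir_correct ::
  "'w measure \<Rightarrow> nat \<Rightarrow> nat \<Rightarrow> nat \<Rightarrow> (nat \<Rightarrow> 'w \<Rightarrow> 'a::{field,finite} Matrix.vec) \<Rightarrow>
    (nat \<Rightarrow> nat \<Rightarrow> 'w \<Rightarrow> 'a mat) \<Rightarrow> bool" where
  "pir_correct \<Omega> M S L W Q \<longleftrightarrow>
     (\<forall>m\<in>{1..M}.
        cond_entropy_of (real CARD('a)) \<Omega> (W m)
          (\<lambda>\<omega>. (\<lambda>j\<in>{1..S}. pir_response M L W Q m j \<omega>, \<lambda>j\<in>{1..S}. Q m j \<omega>)) = 0)"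

definition pir_private ::
  "'w measure \<Rightarrow> nat \<Rightarrow> nat \<Rightarrow> (nat \<Rightarrow> nat \<Rightarrow> 'w \<Rightarrow> 'a mat) \<Rightarrow> bool" where
  "pir_private \<Omega> M S Q \<longleftrightarrow>
     (\<forall>j\<in>{1..S}. \<forall>m\<in>{1..M}. \<forall>m'\<in>{1..M}.
        distr \<Omega> (count_space UNIV) (Q m j) = distr \<Omega> (count_space UNIV) (Q m' j))"

definition pir_rate ::
  "'w measure \<Rightarrow> nat \<Rightarrow> nat \<Rightarrow> nat \<Rightarrow> (nat \<Rightarrow> 'w \<Rightarrow> 'a::{field,finite} Matrix.vec) \<Rightarrow>
    (nat \<Rightarrow> nat \<Rightarrow> 'w \<Rightarrow> 'a mat) \<Rightarrow> real" where
  "pir_rate \<Omega> M S L W Q =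
     Min ((\<lambda>m. entropy_of (real CARD('a)) \<Omega> (W m) /
               (\<Sum>i\<in>{1..S}. cond_entropy_of (real CARD('a)) \<Omega> (pir_response M L W Q m i) (Q m i)))
          ` {1..M})"

definition possible_queries ::
  "'w measure \<Rightarrow> nat \<Rightarrow> (nat \<Rightarrow> nat \<Rightarrow> 'w \<Rightarrow> 'a mat) \<Rightarrow> nat \<Rightarrow> (nat \<Rightarrow> 'a mat) set" where
  "possible_queries \<Omega> S Q m =
     {q. measure \<Omega> {\<omega> \<in> space \<Omega>. \<forall>j\<in>{1..S}. Q m j \<omega> = q j} > 0}"

end

theory Submission
  imports Defs "Berlekamp_Zassenhaus.Berlekamp_Type_Based"
begin

text \<open>A matrix of rank \<open>r\<close> over a field of order \<open>p\<close> takes \<open>p ^ r\<close> values, so all rank relations reduce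
  to counting the values of the responses when the messages outside a set \<open>J\<close> are zero. If message
  \<open>m\<close> in \<open>J\<close> can be decoded, removing it lowers the stacked rank by exactly \<open>L\<close>. Since the stacked rank
  lies between each server's rank and the sum of these ranks, and privacy makes the sum \<open>D J\<close> of the
  servers' expected ranks independent of the wanted message, \<open>D J \<ge> L + D (J - {m}) / S\<close>. The rate is
  \<open>L / D {1..M}\<close>, and it is the capacity iff all these inequalities are equalities, that is, iff for
  almost all queries both comparisons of ranks are equalities. For the smaller sets, condition (1)
  follows from the one for \<open>{1..M} - {m}\<close>: equal ranks mean that the response of one server determines
  those of all others.\<close>

unbundle no vec_syntax

section \<open>Counting with ranks\<close>

text \<open>Privacy controls only the law of each single query, whereas the stacked rank depends on
  the joint law, which may change with the wanted message. The recursion therefore must not mention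
  the stacked rank: it is eliminated for each realization separately, and bounding it from below by
  the average of the servers' ranks is where \<open>1 / S\<close> comes from. What remains are sums
  of single-server expectations, which can be transferred from one wanted message to another.
  Entropy enters twice. The fibres of a linear map have equal size, so a response to uniform
  messages is uniform on its range, and its entropy is the rank. Correctness turns into a statement
  about every possible realization because the queries are independent of the uniform messages, so
  each possible query meets each word of message symbols with positive probability. Unrolled, the
  recursion gives \<open>L * (1 + 1/S + ... + 1/S^(M-1))\<close>, and \<open>L\<close> divided by
  this is the capacity.\<close>

lemma (in vec_space) card_span_lin_indpt:
  assumes "finite U" "U \<subseteq> carrier_vec n" "lin_indpt U"
  shows "card (span U) = CARD('a) ^ card U"
proof -
  \<comment> \<open>Coefficient functions are taken extensional on \<open>U\<close>, so that equal
    linear combinations come from equal functions and not merely from functions that agree on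
    \<open>U\<close>.\<close>
  let ?F = "PiE U (\<lambda>_. UNIV :: 'a set)"
  have "(\<lambda>a. lincomb a U) ` ?F = span U"
  proof -
    have "lincomb a U \<in> (\<lambda>a. lincomb a U) ` ?F" for a
    proof (rule image_eqI[of _ _ "restrict a U"])
      show "lincomb a U = lincomb (restrict a U) U"
        using assms by (intro lincomb_cong) auto
    qed auto
    then show ?thesis
      using finite_span[OF assms(1)] assms(2) by auto
  qed
  moreover have "inj_on (\<lambda>a. lincomb a U) ?F"
  proof (rule inj_onI)
    fix a b assume ab: "a \<in> ?F" "b \<in> ?F" and eq: "lincomb a U = lincomb b U"
    have "lincomb (\<lambda>v. a v - b v) U = 0\<^sub>v n"
    proof (rule eq_vecI)
      show "dim_vec (lincomb (\<lambda>v. a v - b v) U) = dim_vec (0\<^sub>v n)"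
        using lincomb_closed[of U "\<lambda>v. a v - b v"] assms(2) by auto
      fix i assume "i < dim_vec (0\<^sub>v n)"
      then have i: "i < n" by simp
      have "lincomb a U $ i = lincomb b U $ i" using eq by simp
      then show "lincomb (\<lambda>v. a v - b v) U $ i = 0\<^sub>v n $ i"
        unfolding lincomb_index[OF i assms(2)] using i
        by (simp add: left_diff_distrib sum_subtractf)
    qed
    then have "(\<lambda>v. a v - b v) \<in> U \<rightarrow> {0}"
      using not_lindepD[OF assms(3,1) order.refl] by (auto simp: class_ring_simps)
    then have "a v = b v" if "v \<in> U" for v using that by auto
    then show "a = b" using PiE_ext[OF ab] by auto
  qed
  ultimately have "card (span U) = card ?F" by (metis card_image)
  also have "\<dots> = CARD('a) ^ card U" using assms(1) by (simp add: card_PiE)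
  finally show ?thesis .
qed

text \<open>A maximal independent set of columns has \<open>mat_rank A\<close> elements and spans
  the column space, which is the set of all products with \<open>A\<close>.\<close>

lemma card_mult_image_eq_power_rank:
  fixes A :: "'a::{field,finite} mat"
  shows "card ((*\<^sub>v) A ` carrier_vec (dim_col A)) = CARD('a) ^ mat_rank A"
proof -
  interpret vec_space "TYPE('a)" "dim_row A" .
  have A: "A \<in> carrier_mat (dim_row A) (dim_col A)" by simp
  have colsA: "set (cols A) \<subseteq> carrier_vec (dim_row A)" using cols_dim by blast
  obtain U where U: "finite U" "maximal U (\<lambda>T. T \<subseteq> set (cols A) \<and> lin_indpt T)"
    using maximal_exists_superset[of "set (cols A)" "\<lambda>T. T \<subseteq> set (cols A) \<and> lin_indpt T" "{}"]
    by (auto simp: lin_dep_def)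
  have rk: "rank A = card U" using rank_card_indpt[OF A U(2)] .
  have U': "U \<subseteq> set (cols A)" "lin_indpt U" using U(2) by (auto simp: maximal_def)
  have "set (cols A) \<subseteq> span U"
  proof
    fix v assume v: "v \<in> set (cols A)"
    show "v \<in> span U"
    proof (rule ccontr)
      assume nv: "v \<notin> span U"
      then have "v \<notin> U" using in_own_span U' colsA by blast
      moreover have "U \<subseteq> carrier_vec (dim_row A)" "v \<in> carrier_vec (dim_row A)"
        using U' colsA v by blast+
      then have "lin_indpt (U \<union> {v})"
        using lin_dep_iff_in_span[of U v] U'(2) nv \<open>v \<notin> U\<close> by simp
      then have "U \<union> {v} = U"
        using U(2) v U'(1) unfolding maximal_def
        by (metis Un_insert_right Un_empty_right insert_subset subset_insertI)
      ultimately show False by blast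
    qed
  qed
  moreover have Uc: "U \<subseteq> carrier_vec (dim_row A)" using U' colsA by blast
  ultimately have "span (set (cols A)) \<subseteq> span U"
    using span_is_subset[OF _ span_is_submodule] by simp
  then have "span (set (cols A)) = span U"
    using span_is_monotone[OF U'(1)] by blast
  moreover have "span (set (cols A)) = (*\<^sub>v) A ` carrier_vec (dim_col A)"
    unfolding col_space_def[symmetric] col_space_eq[OF A]
    using mult_mat_vec_carrier[OF A] by auto
  ultimately show ?thesis
    using card_span_lin_indpt[OF U(1) Uc U'(2)] rk
    by (simp add: mat_rank_def)
qed

text \<open>Rank comparisons go through this: two maps that identify the same arguments have images
  in bijection, so no linear map between the images has to be constructed.\<close>

lemma card_image_eq_of_same_fibres:
  assumes "\<And>x y. x \<in> C \<Longrightarrow> y \<in> C \<Longrightarrow> f x = f y \<longleftrightarrow> g x = g y"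
  shows "card (f ` C) = card (g ` C)"
proof -
  let ?h = "\<lambda>z. g (inv_into C f z)"
  have h: "?h (f x) = g x" if "x \<in> C" for x
    using assms[of "inv_into C f (f x)" x] that by (simp add: f_inv_into_f inv_into_into)
  have "inj_on ?h (f ` C)"
    using assms h by (auto intro!: inj_onI)
  moreover have "?h ` f ` C = g ` C"
    using h by (simp add: image_image)
  ultimately show ?thesis by (metis card_image)
qed

text \<open>Message symbols are addressed by the column of the query they are multiplied with, as a function
  \<open>u\<close> of the column number; this avoids the renumbering of columns done by \<open>submatrix\<close>.\<close>

definition col_mult :: "'a::semiring_0 mat \<Rightarrow> nat set \<Rightarrow> (nat \<Rightarrow> 'a) \<Rightarrow> 'a Matrix.vec" where
  "col_mult A K u = vec (dim_row A) (\<lambda>i. \<Sum>c\<in>K. A $$ (i, c) * u c)"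

definition joint_mult ::
  "nat \<Rightarrow> (nat \<Rightarrow> 'a::semiring_0 mat) \<Rightarrow> nat set \<Rightarrow> (nat \<Rightarrow> 'a) \<Rightarrow> nat \<Rightarrow> 'a Matrix.vec" where
  "joint_mult S q K u = (\<lambda>j\<in>{1..S}. col_mult (q j) K u)"

definition block_cols :: "nat \<Rightarrow> nat set \<Rightarrow> nat set" where
  "block_cols L J = (\<Union>k\<in>J. {(k - 1) * L..<k * L})"

lemma col_mult_cong: "(\<And>c. c \<in> K \<Longrightarrow> u c = u' c) \<Longrightarrow> col_mult A K u = col_mult A K u'"
  by (simp add: col_mult_def)

text \<open>Extension by zero turns a word on few columns into a word on many, so that injectivity
  or decoding known for the larger set applies to the smaller one.\<close>

lemma col_mult_subset:
  assumes "finite K" "K' \<subseteq> K"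
  shows "col_mult A K' u = col_mult A K (\<lambda>c. if c \<in> K' then u c else 0)"
  unfolding col_mult_def
  by (intro eq_vecI; simp; intro sum.mono_neutral_cong_left) (use assms in auto)

lemma joint_mult_subset:
  assumes "finite K" "K' \<subseteq> K"
  shows "joint_mult S q K' u = joint_mult S q K (\<lambda>c. if c \<in> K' then u c else 0)"
  unfolding joint_mult_def by (rule restrict_ext) (rule col_mult_subset[OF assms])

lemma col_mult_eq_iff:
  "col_mult A K u = col_mult A K u' \<longleftrightarrow>
    (\<forall>i<dim_row A. (\<Sum>c\<in>K. A $$ (i, c) * u c) = (\<Sum>c\<in>K. A $$ (i, c) * u' c))"
  by (auto simp: col_mult_def vec_eq_iff)

lemma joint_mult_eq_iff:
  "joint_mult S q K u = joint_mult S q K u' \<longleftrightarrow>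
    (\<forall>j\<in>{1..S}. col_mult (q j) K u = col_mult (q j) K u')"
  by (auto simp: joint_mult_def restrict_def fun_eq_iff)

lemma finite_range_col_mult: "finite (range (col_mult (A :: 'a::{semiring_0,finite} mat) K))"
  by (rule finite_subset[OF _ finite_carrier_vec[of "dim_row A"]]) (auto simp: col_mult_def)

lemma range_joint_mult_subset:
  "range (joint_mult S q K) \<subseteq> PiE {1..S} (\<lambda>j. range (col_mult (q j) K))"
  by (auto simp: joint_mult_def)

lemma finite_range_joint_mult:
  "finite (range (joint_mult S (q :: nat \<Rightarrow> 'a::{semiring_0,finite} mat) K))"
  by (rule finite_subset[OF range_joint_mult_subset]) (simp add: finite_PiE finite_range_col_mult)

text \<open>\<open>pick K i\<close> is the element of \<open>K\<close> with exactly \<open>i\<close>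
  elements of \<open>K\<close> below it, so counting smaller elements inverts it.\<close>

lemma bij_betw_pick:
  assumes "finite K"
  shows "bij_betw (pick K) {..<card K} K"
proof (rule bij_betw_imageI)
  show "inj_on (pick K) {..<card K}"
    by (rule inj_on_inverseI[of _ "\<lambda>c. card {a \<in> K. a < c}"]) (simp add: card_pick_le)
  show "pick K ` {..<card K} = K"
  proof (intro equalityI subsetI)
    fix c assume c: "c \<in> K"
    have "card {a \<in> K. a < c} < card K"
      using assms c by (intro psubset_card_mono) auto
    then show "c \<in> pick K ` {..<card K}"
      by (intro image_eqI[where f = "pick K", OF pick_card_in_set[OF c, symmetric]]) simp
  next
    fix c assume "c \<in> pick K ` {..<card K}"
    then show "c \<in> K" using pick_in_set_le by (metis imageE lessThan_iff)
  qed
qed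

lemma submatrix_mult_vec:
  assumes "K \<subseteq> {..<dim_col A}"
  shows "submatrix A UNIV K *\<^sub>v vec (card K) (\<lambda>i. u (pick K i)) = col_mult A K u"
proof -
  have K: "finite K" "{j. j < dim_col A \<and> j \<in> K} = K"
    using assms finite_subset[OF assms] by auto
  have "(\<Sum>l<card K. A $$ (i, pick K l) * u (pick K l)) = (\<Sum>c\<in>K. A $$ (i, c) * u c)" for i
    by (rule sum.reindex_bij_betw[OF bij_betw_pick[OF K(1)]])
  then show ?thesis
    by (intro eq_vecI)
      (auto simp: submatrix_def col_mult_def scalar_prod_def K pick_UNIV atLeast0LessThan)
qed

lemma vec_pick_surj:
  assumes "finite K" "v \<in> carrier_vec (card K)"
  obtains u where "v = vec (card K) (\<lambda>i. u (pick K i))"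
proof
  show "v = vec (card K) (\<lambda>i. (\<lambda>c. v $ inv_into {..<card K} (pick K) c) (pick K i))"
    using assms bij_betw_imp_inj_on[OF bij_betw_pick[OF assms(1)]]
    by (auto simp: inv_into_f_f)
qed

lemma range_col_mult:
  assumes "K \<subseteq> {..<dim_col A}"
  shows "range (col_mult A K) = (*\<^sub>v) (submatrix A UNIV K) ` carrier_vec (card K)"
proof -
  have "finite K" using assms finite_subset by auto
  then have "\<exists>u. v = vec (card K) (\<lambda>i. u (pick K i))" if "v \<in> carrier_vec (card K)" for v
    using that vec_pick_surj by blast
  then show ?thesis
    unfolding submatrix_mult_vec[OF assms, symmetric] by fastforce
qed

lemma range_joint_mult:
  assumes "\<And>j. j \<in> {1..S} \<Longrightarrow> K \<subseteq> {..<dim_col (q j)}" "finite K"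
  shows "range (joint_mult S q K) =
    (\<lambda>v. \<lambda>j\<in>{1..S}. submatrix (q j) UNIV K *\<^sub>v v) ` carrier_vec (card K)"
proof -
  have *: "joint_mult S q K u =
      (\<lambda>j\<in>{1..S}. submatrix (q j) UNIV K *\<^sub>v vec (card K) (\<lambda>i. u (pick K i)))" for u
    unfolding joint_mult_def by (rule restrict_ext) (simp add: submatrix_mult_vec assms)
  show ?thesis
  proof (intro equalityI subsetI)
    fix y assume "y \<in> (\<lambda>v. \<lambda>j\<in>{1..S}. submatrix (q j) UNIV K *\<^sub>v v) ` carrier_vec (card K)"
    then obtain v where v: "v \<in> carrier_vec (card K)"
      "y = (\<lambda>j\<in>{1..S}. submatrix (q j) UNIV K *\<^sub>v v)" by blast
    obtain u where u: "v = vec (card K) (\<lambda>i. u (pick K i))"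
      using vec_pick_surj[OF assms(2) v(1)] .
    show "y \<in> range (joint_mult S q K)"
      unfolding v(2) u *[symmetric] by (rule rangeI)
  qed (auto simp: *)
qed

text \<open>Blocks with distinct positive numbers are disjoint intervals of length \<open>L\<close>.
  The number 0 is excluded because truncated subtraction makes its block empty.\<close>

lemma card_block_cols:
  assumes "finite J" "J \<subseteq> {1..}"
  shows "card (block_cols L J) = card J * L"
proof -
  have "{(i - 1) * L..<i * L} \<inter> {(j - 1) * L..<j * L} = {}" if "i < j" for i j
  proof -
    have "i * L \<le> (j - 1) * L" using that by (intro mult_right_mono) auto
    then show ?thesis by auto
  qed
  then have "{(i - 1) * L..<i * L} \<inter> {(j - 1) * L..<j * L} = {}" if "i \<noteq> j" for i j
    using that by (metis inf_commute linorder_neqE_nat)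
  then have "card (block_cols L J) = (\<Sum>k\<in>J. card {(k - 1) * L..<k * L})"
    unfolding block_cols_def using assms(1) by (intro card_UN_disjoint) auto
  also have "\<dots> = (\<Sum>k\<in>J. L)"
  proof (rule sum.cong[OF refl])
    fix k assume "k \<in> J"
    then have "k \<ge> 1" using assms(2) by auto
    then show "card {(k - 1) * L..<k * L} = L" by (cases k) auto
  qed
  finally show ?thesis by simp
qed

lemma block_cols_subset:
  assumes "J \<subseteq> {1..M}"
  shows "block_cols L J \<subseteq> {..<M * L}"
proof
  fix c assume "c \<in> block_cols L J"
  then obtain k where "k \<in> J" "c < k * L" by (auto simp: block_cols_def)
  moreover from this have "k * L \<le> M * L" using assms by (intro mult_right_mono) auto
  ultimately show "c \<in> {..<M * L}" by (meson lessThan_iff order.strict_trans2)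
qed

lemma mult_mat_vec_eq_iff_rows:
  "A *\<^sub>v v = A *\<^sub>v v' \<longleftrightarrow> (\<forall>r\<in>set (rows A). r \<bullet> v = r \<bullet> v')"
  by (auto simp: vec_eq_iff rows_def)

lemma stack_rows_mult_eq_iff:
  assumes "\<And>A. A \<in> set As \<Longrightarrow> dim_col A = n"
  shows "stack_rows n As *\<^sub>v v = stack_rows n As *\<^sub>v v' \<longleftrightarrow> (\<forall>A\<in>set As. A *\<^sub>v v = A *\<^sub>v v')"
proof -
  have "set (concat (map rows As)) \<subseteq> carrier_vec n"
    using subsetD[OF rows_carrier] assms by fastforce
  then show ?thesis
    by (simp add: mult_mat_vec_eq_iff_rows stack_rows_def)
qed

lemma card_range_col_mult:
  fixes A :: "'a::{field,finite} mat"
  assumes "K \<subseteq> {..<dim_col A}"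
  shows "card (range (col_mult A K)) = CARD('a) ^ mat_rank (submatrix A UNIV K)"
proof -
  have "{j. j < dim_col A \<and> j \<in> K} = K" using assms by auto
  then have "dim_col (submatrix A UNIV K) = card K" by (simp add: dim_submatrix)
  then show ?thesis
    using card_mult_image_eq_power_rank[of "submatrix A UNIV K"] range_col_mult[OF assms] by simp
qed

text \<open>The joint answers and the stacked matrix identify the same vectors, since equality of
  products can be checked row by row. The positions of the rows after stacking never matter.\<close>

lemma card_range_joint_mult:
  fixes q :: "nat \<Rightarrow> 'a::{field,finite} mat"
  assumes q: "\<And>j. j \<in> {1..S} \<Longrightarrow> dim_col (q j) = M * L" and J: "J \<subseteq> {1..M}"
  shows "card (range (joint_mult S q (block_cols L J))) =
    CARD('a) ^ mat_rank (stacked_query_part S L J q)"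
proof -
  let ?K = "block_cols L J" and ?As = "map (\<lambda>j. query_part L J (q j)) [1..<Suc S]"
  have Jfin: "finite J" "J \<subseteq> {1..}" using J finite_subset[OF J] by auto
  have K: "?K \<subseteq> {..<M * L}" "finite ?K" "card ?K = card J * L"
    using block_cols_subset[OF J] finite_subset[OF block_cols_subset[OF J]] card_block_cols[OF Jfin]
    by auto
  then have "{j. j < M * L \<and> j \<in> ?K} = ?K" by auto
  then have dims: "dim_col A = card ?K" if "A \<in> set ?As" for A
    using that q by (auto simp: query_part_def dim_submatrix block_cols_def)
  have "range (joint_mult S q ?K) =
      (\<lambda>v. \<lambda>j\<in>{1..S}. submatrix (q j) UNIV ?K *\<^sub>v v) ` carrier_vec (card ?K)"
    by (rule range_joint_mult) (use q K in auto)
  moreover have "card \<dots> = card ((*\<^sub>v) (stack_rows (card ?K) ?As) ` carrier_vec (card ?K))"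
  proof (rule card_image_eq_of_same_fibres)
    fix v v'
    have "(\<lambda>j\<in>{1..S}. submatrix (q j) UNIV ?K *\<^sub>v v) = (\<lambda>j\<in>{1..S}. submatrix (q j) UNIV ?K *\<^sub>v v') \<longleftrightarrow>
        (\<forall>j\<in>{1..S}. submatrix (q j) UNIV ?K *\<^sub>v v = submatrix (q j) UNIV ?K *\<^sub>v v')"
      by (auto simp: restrict_def fun_eq_iff)
    also have "\<dots> \<longleftrightarrow> (\<forall>A\<in>set ?As. A *\<^sub>v v = A *\<^sub>v v')"
      by (auto simp: query_part_def block_cols_def atLeastLessThanSuc_atLeastAtMost
        simp del: upt_Suc)
    also have "\<dots> \<longleftrightarrow> stack_rows (card ?K) ?As *\<^sub>v v = stack_rows (card ?K) ?As *\<^sub>v v'"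
      by (rule stack_rows_mult_eq_iff[symmetric]) (rule dims)
    finally show "(\<lambda>j\<in>{1..S}. submatrix (q j) UNIV ?K *\<^sub>v v) = (\<lambda>j\<in>{1..S}. submatrix (q j) UNIV ?K *\<^sub>v v') \<longleftrightarrow>
        stack_rows (card ?K) ?As *\<^sub>v v = stack_rows (card ?K) ?As *\<^sub>v v'" .
  qed
  moreover have "dim_col (stack_rows (card ?K) ?As) = card ?K" by (simp add: stack_rows_def)
  ultimately show ?thesis
    using card_mult_image_eq_power_rank[of "stack_rows (card ?K) ?As"] K(3)
    by (simp add: stacked_query_part_def)
qed

section \<open>Ranks of the parts of a query\<close>

definition query_rank :: "nat \<Rightarrow> nat set \<Rightarrow> 'a::field mat \<Rightarrow> nat" where
  "query_rank L J A = mat_rank (query_part L J A)"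

definition stacked_rank :: "nat \<Rightarrow> nat \<Rightarrow> nat set \<Rightarrow> (nat \<Rightarrow> 'a::field mat) \<Rightarrow> nat" where
  "stacked_rank S L J q = mat_rank (stacked_query_part S L J q)"

text \<open>Correctness for one realization of the queries, with probability removed: equal answers
  of all servers force equal symbols of message \<open>m\<close>.\<close>

definition decodes :: "nat \<Rightarrow> nat \<Rightarrow> nat \<Rightarrow> (nat \<Rightarrow> 'a::semiring_0 mat) \<Rightarrow> nat \<Rightarrow> bool" where
  "decodes M S L q m \<longleftrightarrow>
    (\<forall>u u'. joint_mult S q {..<M * L} u = joint_mult S q {..<M * L} u' \<longrightarrow>
      (\<forall>c\<in>block_cols L {m}. u c = u' c))"

lemma card_field_gt_1: "CARD('a::{field,finite}) > 1"
proof -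
  have "card {0, 1 :: 'a} \<le> CARD('a)" by (rule card_mono) auto
  then show ?thesis by simp
qed

lemma block_cols_empty [simp]: "block_cols L {} = {}"
  by (simp add: block_cols_def)

lemma block_cols_mono: "J \<subseteq> J' \<Longrightarrow> block_cols L J \<subseteq> block_cols L J'"
  by (auto simp: block_cols_def)

text \<open>By counting: the cardinality of the union is the sum of the two cardinalities, which
  leaves nothing for the intersection.\<close>

lemma block_cols_disjoint:
  assumes "m \<notin> J" "m \<ge> 1" "J \<subseteq> {1..}" "finite J"
  shows "block_cols L {m} \<inter> block_cols L J = {}"
proof -
  have fin: "finite (block_cols L {m})" "finite (block_cols L J)"
    using assms(4) by (auto simp: block_cols_def)
  have "block_cols L (insert m J) = block_cols L {m} \<union> block_cols L J"
    by (auto simp: block_cols_def)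
  moreover have "card (block_cols L (insert m J)) = card (block_cols L {m}) + card (block_cols L J)"
    using assms by (simp add: card_block_cols)
  ultimately show ?thesis using card_Un_Int[OF fin] fin by simp
qed

text \<open>A single realization of the queries as plain data, without a probability space; it is
  interpreted later for individual realizations.\<close>

locale query_family =
  fixes M S L :: nat and q :: "nat \<Rightarrow> 'a::{field,finite} mat"
  assumes dim_col_q: "j \<in> {1..S} \<Longrightarrow> dim_col (q j) = M * L"
begin

lemma card_range_query:
  assumes "J \<subseteq> {1..M}" "j \<in> {1..S}"
  shows "card (range (col_mult (q j) (block_cols L J))) = CARD('a) ^ query_rank L J (q j)"
  using card_range_col_mult[of "block_cols L J" "q j"] block_cols_subset[OF assms(1)]
    dim_col_q[OF assms(2)]
  by (simp add: query_rank_def query_part_def block_cols_def)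

lemma card_range_stacked:
  assumes "J \<subseteq> {1..M}"
  shows "card (range (joint_mult S q (block_cols L J))) = CARD('a) ^ stacked_rank S L J q"
  using card_range_joint_mult[OF dim_col_q assms] by (simp add: stacked_rank_def)

text \<open>The joint values lie in the product of the servers' ranges, and the size of that product
  turns into a sum of exponents.\<close>

lemma stacked_rank_le_sum:
  assumes "J \<subseteq> {1..M}"
  shows "stacked_rank S L J q \<le> (\<Sum>j\<in>{1..S}. query_rank L J (q j))"
proof -
  let ?K = "block_cols L J"
  have "card (range (joint_mult S q ?K)) \<le> card (PiE {1..S} (\<lambda>j. range (col_mult (q j) ?K)))"
    by (rule card_mono[OF _ range_joint_mult_subset]) (simp add: finite_PiE finite_range_col_mult)
  also have "\<dots> = (\<Prod>j\<in>{1..S}. CARD('a) ^ query_rank L J (q j))"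
    by (simp only: card_PiE finite_atLeastAtMost card_range_query[OF assms] cong: prod.cong)
  also have "\<dots> = CARD('a) ^ (\<Sum>j\<in>{1..S}. query_rank L J (q j))"
    by (simp add: power_sum)
  finally show ?thesis
    using card_field_gt_1[where 'a = 'a] by (simp add: card_range_stacked[OF assms])
qed

lemma range_query_eq:
  assumes "j \<in> {1..S}"
  shows "range (col_mult (q j) K) = (\<lambda>f. f j) ` range (joint_mult S q K)"
  using assms by (auto simp: joint_mult_def image_image)

lemma query_rank_le_stacked_rank:
  assumes "J \<subseteq> {1..M}" "j \<in> {1..S}"
  shows "query_rank L J (q j) \<le> stacked_rank S L J q"
proof -
  let ?K = "block_cols L J"
  have "card (range (col_mult (q j) ?K)) \<le> card (range (joint_mult S q ?K))"
    unfolding range_query_eq[OF assms(2)] by (rule card_image_le) (rule finite_range_joint_mult)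
  then show ?thesis
    using card_field_gt_1[where 'a = 'a] by (simp add: card_range_stacked[OF assms(1)] card_range_query[OF assms])
qed

text \<open>Equal ranks make the projection from the joint values to those of server \<open>j\<close> injective, and it stays
  injective on words supported on a smaller set of blocks.\<close>

lemma query_rank_eq_stacked_rank_subset:
  assumes J: "J \<subseteq> {1..M}" "J' \<subseteq> J" and j: "j \<in> {1..S}"
    and eq: "query_rank L J (q j) = stacked_rank S L J q"
  shows "query_rank L J' (q j) = stacked_rank S L J' q"
proof -
  let ?K = "block_cols L J" and ?K' = "block_cols L J'"
  have K: "finite ?K" "?K' \<subseteq> ?K"
    using J by (auto intro: finite_subset[OF block_cols_subset[OF J(1)]] block_cols_mono[THEN subsetD])
  have "card ((\<lambda>f. f j) ` range (joint_mult S q ?K)) = card (range (joint_mult S q ?K))"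
    using eq by (simp add: range_query_eq[OF j, symmetric] card_range_stacked[OF J(1)] card_range_query[OF J(1) j])
  then have inj: "inj_on (\<lambda>f. f j) (range (joint_mult S q ?K))"
    by (intro eq_card_imp_inj_on finite_range_joint_mult)
  have "card (range (col_mult (q j) ?K')) = card (range (joint_mult S q ?K'))"
  proof (rule card_image_eq_of_same_fibres)
    fix u u'
    show "col_mult (q j) ?K' u = col_mult (q j) ?K' u' \<longleftrightarrow>
        joint_mult S q ?K' u = joint_mult S q ?K' u'"
    proof
      assume "col_mult (q j) ?K' u = col_mult (q j) ?K' u'"
      then have "joint_mult S q ?K' u j = joint_mult S q ?K' u' j"
        using j by (simp add: joint_mult_def)
      then show "joint_mult S q ?K' u = joint_mult S q ?K' u'"
        unfolding joint_mult_subset[OF K] using inj_onD[OF inj] by blast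
    qed (use j in \<open>simp add: joint_mult_eq_iff\<close>)
  qed
  then show ?thesis
    using card_field_gt_1[where 'a = 'a] card_range_stacked[of J'] card_range_query[OF _ j, of J'] J
    by simp
qed

text \<open>The joint answers on \<open>J\<close> carry the same information as the symbols of
  message \<open>m\<close> together with the joint answers on \<open>J - {m}\<close>: decoding
  yields the symbols, and subtracting their contribution yields the rest. The two components vary
  independently, so the first contributes a factor \<open>CARD('a) ^ L\<close>.\<close>

lemma stacked_rank_eq_decoded:
  assumes dec: "decodes M S L q m" and J: "J \<subseteq> {1..M}" "m \<in> J"
  shows "stacked_rank S L J q = L + stacked_rank S L (J - {m}) q"
proof -
  let ?B = "block_cols L {m}" and ?R = "block_cols L (J - {m})" and ?K = "block_cols L J"
  have m: "m \<ge> 1" and Jfin: "finite J" "J \<subseteq> {1..}" using J finite_subset[OF J(1)] by auto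
  have KM: "?K \<subseteq> {..<M * L}" using block_cols_subset[OF J(1)] .
  have K: "?K = ?B \<union> ?R" using J(2) by (auto simp: block_cols_def)
  have fin: "finite ?K" using finite_subset[OF KM] by simp
  then have fin': "finite ?B" "finite ?R" unfolding K by simp_all
  have disj: "?B \<inter> ?R = {}" using m Jfin by (intro block_cols_disjoint) auto
  have split: "(\<Sum>c\<in>?K. A $$ (i, c) * u c) =
      (\<Sum>c\<in>?B. A $$ (i, c) * u c) + (\<Sum>c\<in>?R. A $$ (i, c) * u c)" for A :: "'a mat" and i u
    unfolding K by (rule sum.union_disjoint[OF fin' disj])
  let ?g = "\<lambda>u. (restrict u ?B, joint_mult S q ?R u)"
  have "card (range (joint_mult S q ?K)) = card (range ?g)"
  proof (rule card_image_eq_of_same_fibres)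
    fix u u' :: "nat \<Rightarrow> 'a"
    have same: "joint_mult S q ?K u = joint_mult S q ?K u' \<longleftrightarrow>
        joint_mult S q ?R u = joint_mult S q ?R u'" if "\<And>c. c \<in> ?B \<Longrightarrow> u c = u' c"
    proof -
      have "(\<Sum>c\<in>?B. A $$ (i, c) * u c) = (\<Sum>c\<in>?B. A $$ (i, c) * u' c)" for A :: "'a mat" and i
        using that by (intro sum.cong) auto
      then show ?thesis
        unfolding joint_mult_eq_iff col_mult_eq_iff split by simp
    qed
    have "u c = u' c" if eq: "joint_mult S q ?K u = joint_mult S q ?K u'" and c: "c \<in> ?B" for c
    proof -
      \<comment> \<open>Decoding speaks about words on all columns, so both words are extended by
        zero outside \<open>?K\<close>.\<close>
      have "(if c \<in> ?K then u c else 0) = (if c \<in> ?K then u' c else 0)"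
        using eq unfolding joint_mult_subset[OF finite_lessThan KM]
        by (rule dec[unfolded decodes_def, rule_format, OF _ c])
      moreover have "c \<in> ?K" using c unfolding K by simp
      ultimately show ?thesis by simp
    qed
    moreover have "restrict u ?B = restrict u' ?B \<longleftrightarrow> (\<forall>c\<in>?B. u c = u' c)"
      by (auto simp: restrict_def fun_eq_iff)
    ultimately show "joint_mult S q ?K u = joint_mult S q ?K u' \<longleftrightarrow> ?g u = ?g u'"
      using same by auto
  qed
  also have "range ?g = PiE ?B (\<lambda>_. UNIV) \<times> range (joint_mult S q ?R)"
  proof (intro equalityI subsetI)
    fix x assume "x \<in> PiE ?B (\<lambda>_. UNIV :: 'a set) \<times> range (joint_mult S q ?R)"
    then obtain b u0 where b: "b \<in> PiE ?B (\<lambda>_. UNIV)" and x: "x = (b, joint_mult S q ?R u0)"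
      by blast
    \<comment> \<open>Since the blocks of \<open>m\<close> and of \<open>J - {m}\<close> are
      disjoint, the word can be prescribed separately on each of them, which shows that every pair
      is attained.\<close>
    let ?u = "\<lambda>c. if c \<in> ?B then b c else u0 c"
    have "restrict ?u ?B = b" using b by (auto simp: restrict_def fun_eq_iff PiE_def extensional_def)
    moreover have "joint_mult S q ?R ?u = joint_mult S q ?R u0"
      unfolding joint_mult_eq_iff using disj by (intro ballI col_mult_cong) auto
    ultimately have "x = ?g ?u" using x by (simp only:)
    from image_eqI[where f = ?g, OF this UNIV_I] show "x \<in> range ?g" .
  qed auto
  also have "card \<dots> = CARD('a) ^ (L + stacked_rank S L (J - {m}) q)"
  proof -
    have "card (PiE ?B (\<lambda>_. UNIV :: 'a set)) = CARD('a) ^ L"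
      using card_block_cols[of "{m}" L] m fin' by (simp add: card_PiE)
    moreover have "card (range (joint_mult S q ?R)) = CARD('a) ^ stacked_rank S L (J - {m}) q"
      using J(1) by (intro card_range_stacked) blast
    ultimately show ?thesis by (simp only: card_cartesian_product power_add)
  qed
  finally show ?thesis
    using card_field_gt_1[where 'a = 'a] by (simp add: card_range_stacked[OF J(1)])
qed

lemma query_rank_empty:
  assumes "j \<in> {1..S}"
  shows "query_rank L {} (q j) = 0"
proof -
  have "col_mult (q j) {} = (\<lambda>_. 0\<^sub>v (dim_row (q j)))"
    by (auto simp: col_mult_def fun_eq_iff)
  then show ?thesis
    using card_range_query[OF _ assms, of "{}"] card_field_gt_1[where 'a = 'a]
    by (cases "query_rank L {} (q j)") auto
qed

end

section \<open>Entropy of simple random variables\<close>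

lemma (in prob_space) expectation_simple:
  fixes g :: "'b \<Rightarrow> real"
  assumes Y: "simple_function M Y"
  shows "integrable M (\<lambda>\<omega>. g (Y \<omega>))"
    and "expectation (\<lambda>\<omega>. g (Y \<omega>)) = (\<Sum>y\<in>Y ` space M. prob (Y -` {y} \<inter> space M) * g y)"
proof -
  have fin: "finite (Y ` space M)" and ev: "Y -` {y} \<inter> space M \<in> events" for y
    using simple_functionD[OF Y] by auto
  let ?h = "\<lambda>\<omega>. \<Sum>y\<in>Y ` space M. indicator (Y -` {y} \<inter> space M) \<omega> * g y"
  have eq: "g (Y \<omega>) = ?h \<omega>" if \<omega>: "\<omega> \<in> space M" for \<omega>
  proof -
    have "?h \<omega> = (\<Sum>y\<in>{Y \<omega>}. indicator (Y -` {y} \<inter> space M) \<omega> * g y)"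
      using fin \<omega> by (intro sum.mono_neutral_right) (auto simp: indicator_def)
    then show ?thesis using \<omega> by simp
  qed
  have "integrable M ?h" using ev by (auto intro!: integrable_real_indicator simp: emeasure_eq_measure)
  then show "integrable M (\<lambda>\<omega>. g (Y \<omega>))" using eq by (simp cong: Bochner_Integration.integrable_cong)
  have "expectation (\<lambda>\<omega>. g (Y \<omega>)) = expectation ?h"
    by (rule Bochner_Integration.integral_cong[OF refl eq])
  also have "\<dots> = (\<Sum>y\<in>Y ` space M. prob (Y -` {y} \<inter> space M) * g y)"
    using ev by (subst Bochner_Integration.integral_sum)
      (auto intro!: integrable_real_indicator simp: emeasure_eq_measure)
  finally show "expectation (\<lambda>\<omega>. g (Y \<omega>)) = (\<Sum>y\<in>Y ` space M. prob (Y -` {y} \<inter> space M) * g y)" .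
qed

lemma (in information_space) conditional_entropy_sum:
  assumes X: "simple_function M X" and Y: "simple_function M Y"
  shows "\<H>(X | Y) = (\<Sum>(x, y)\<in>(\<lambda>\<omega>. (X \<omega>, Y \<omega>)) ` space M.
    - (prob {\<omega>\<in>space M. X \<omega> = x \<and> Y \<omega> = y} *
       log b (prob {\<omega>\<in>space M. X \<omega> = x \<and> Y \<omega> = y} / prob {\<omega>\<in>space M. Y \<omega> = y})))"
proof -
  have 1: "simple_distributed M Y (\<lambda>y. prob {\<omega>\<in>space M. Y \<omega> = y})"
    by (rule simple_distributedI[OF Y]) (auto intro!: arg_cong[where f = prob])
  have 2: "simple_distributed M (\<lambda>\<omega>. (X \<omega>, Y \<omega>))
      (\<lambda>p. prob {\<omega>\<in>space M. X \<omega> = fst p \<and> Y \<omega> = snd p})"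
    by (rule simple_distributedI[OF simple_function_Pair[OF X Y]])
      (auto intro!: arg_cong[where f = prob])
  show ?thesis
    unfolding conditional_entropy_eq[OF 1 2] by (simp add: sum_negf split_beta')
qed

text \<open>Conditional probabilities are at most 1, so every summand of the conditional entropy is
  nonnegative. A zero sum makes each summand zero, and where the joint probability is positive this
  forces the conditional probability to be 1.\<close>

lemma (in information_space) conditional_entropy_eq_0_imp_determined:
  assumes X: "simple_function M X" and Y: "simple_function M Y" and H: "\<H>(X | Y) = 0"
    and pos: "prob {\<omega>\<in>space M. X \<omega> = x \<and> Y \<omega> = y} > 0"
  shows "prob {\<omega>\<in>space M. Y \<omega> = y} = prob {\<omega>\<in>space M. X \<omega> = x \<and> Y \<omega> = y}"
proof -
  let ?xy = "\<lambda>x y. prob {\<omega>\<in>space M. X \<omega> = x \<and> Y \<omega> = y}"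
  let ?y = "\<lambda>y. prob {\<omega>\<in>space M. Y \<omega> = y}"
  let ?t = "\<lambda>p. - (?xy (fst p) (snd p) * log b (?xy (fst p) (snd p) / ?y (snd p)))"
  let ?I = "(\<lambda>\<omega>. (X \<omega>, Y \<omega>)) ` space M"
  have evY: "{\<omega>\<in>space M. Y \<omega> = y} \<in> events" for y
    using simple_functionD(2)[OF Y, of "{y}"] by (simp add: vimage_def Int_def conj_commute)
  have le: "?xy x y \<le> ?y y" for x y
    using evY by (intro finite_measure_mono) auto
  have nonneg: "?t p \<ge> 0" for p
  proof (cases "?xy (fst p) (snd p) = 0")
    case False
    then have "?xy (fst p) (snd p) > 0" by (simp add: zero_less_measure_iff)
    moreover from this have "?xy (fst p) (snd p) / ?y (snd p) \<le> 1"
      using le[of "fst p" "snd p"] by (simp add: divide_le_eq)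
    moreover have "?xy (fst p) (snd p) / ?y (snd p) > 0"
      using le[of "fst p" "snd p"] calculation(1) by auto
    ultimately have "log b (?xy (fst p) (snd p) / ?y (snd p)) \<le> 0"
      using b_gt_1 by simp
    then show ?thesis
      using \<open>?xy (fst p) (snd p) > 0\<close> by (simp add: mult_nonneg_nonpos)
  qed simp
  have "(\<Sum>p\<in>?I. ?t p) = 0"
    using H unfolding conditional_entropy_sum[OF X Y] by (simp add: split_beta')
  moreover have "finite ?I" using simple_functionD(1)[OF simple_function_Pair[OF X Y]] .
  moreover have "(x, y) \<in> ?I"
  proof (rule ccontr)
    assume "(x, y) \<notin> ?I"
    then have "{\<omega>\<in>space M. X \<omega> = x \<and> Y \<omega> = y} = {}" by auto
    then show False using pos by (metis less_irrefl measure_empty)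
  qed
  ultimately have "?t (x, y) = 0"
    using nonneg sum_nonneg_eq_0_iff[of ?I ?t] by blast
  then have "log b (?xy x y / ?y y) = 0" using pos by simp
  moreover have "?y y > 0" using le[of x y] pos by linarith
  moreover from this have "?xy x y / ?y y > 0" using pos by simp
  ultimately have "?xy x y / ?y y = 1"
    using b_gt_1 zero_le_log_cancel_iff[of b "?xy x y / ?y y"]
      log_le_zero_cancel_iff[of b "?xy x y / ?y y"] by simp
  then show ?thesis using \<open>?y y > 0\<close> by (simp add: field_simps)
qed

lemma (in information_space) conditional_entropy_uniform_fibres:
  assumes Y: "simple_function M Y" and U: "simple_function M U"
    and UC: "\<And>\<omega>. \<omega> \<in> space M \<Longrightarrow> U \<omega> \<in> C" and C: "finite C"
    and X: "\<And>\<omega>. \<omega> \<in> space M \<Longrightarrow> X \<omega> = f (Y \<omega>) (U \<omega>)"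
    and indep: "\<And>y u. y \<in> Y ` space M \<Longrightarrow> u \<in> C \<Longrightarrow>
      prob {\<omega>\<in>space M. Y \<omega> = y \<and> U \<omega> = u} = prob {\<omega>\<in>space M. Y \<omega> = y} / card C"
    and fibres: "\<And>y x. y \<in> Y ` space M \<Longrightarrow> x \<in> f y ` C \<Longrightarrow>
      card {u\<in>C. f y u = x} * card (f y ` C) = card C"
  shows "\<H>(X | Y) = expectation (\<lambda>\<omega>. log b (card (f (Y \<omega>) ` C)))"
proof -
  let ?p = "\<lambda>y. prob {\<omega>\<in>space M. Y \<omega> = y}"
  let ?xy = "\<lambda>x y. prob {\<omega>\<in>space M. X \<omega> = x \<and> Y \<omega> = y}"
  let ?n = "\<lambda>y. real (card (f y ` C))"
  have YU: "simple_function M (\<lambda>\<omega>. (Y \<omega>, U \<omega>))" using Y U by (rule simple_function_Pair)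
  have X': "simple_function M X"
    using simple_function_compose[OF YU, of "\<lambda>(y, u). f y u"] X
    by (simp add: comp_def cong: simple_function_cong)
  have ev: "{\<omega>\<in>space M. Y \<omega> = y \<and> U \<omega> = u} \<in> events" for y u
    using simple_functionD(2)[OF YU, of "{(y, u)}"] by (simp add: vimage_def Int_def conj_commute)
  have nonempty: "C \<noteq> {}" using UC not_empty by auto
  then have cardC: "card C > 0" using C by (simp add: card_gt_0_iff)
  have n: "?n y > 0" for y
    using C nonempty by (simp add: card_gt_0_iff)
  have xy: "?xy x y = ?p y / ?n y" if y: "y \<in> Y ` space M" and x: "x \<in> f y ` C" for x y
  proof -
    let ?F = "{u\<in>C. f y u = x}"
    have "{\<omega>\<in>space M. X \<omega> = x \<and> Y \<omega> = y} = (\<Union>u\<in>?F. {\<omega>\<in>space M. Y \<omega> = y \<and> U \<omega> = u})"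
      using X UC by auto
    then have "?xy x y = (\<Sum>u\<in>?F. prob {\<omega>\<in>space M. Y \<omega> = y \<and> U \<omega> = u})"
      using C ev by (simp only:) (intro finite_measure_finite_Union, auto simp: disjoint_family_on_def)
    also have "\<dots> = (\<Sum>u\<in>?F. ?p y / card C)"
      using y by (intro sum.cong refl indep) auto
    also have "\<dots> = card ?F * (?p y / card C)" by simp
    also have "\<dots> = ?p y / ?n y"
      using fibres[OF y x, symmetric] cardC n[of y] by (simp add: field_simps)
    finally show ?thesis .
  qed
  let ?I = "(\<lambda>\<omega>. (X \<omega>, Y \<omega>)) ` space M"
  let ?J = "Sigma (Y ` space M) (\<lambda>y. f y ` C)"
  have finY: "finite (Y ` space M)" using simple_functionD(1)[OF Y] .
  have summand: "- (?xy x y * log b (?xy x y / ?p y)) = ?p y / ?n y * log b (?n y)"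
    if "y \<in> Y ` space M" "x \<in> f y ` C" for x y
  proof (cases "?p y = 0")
    case False
    then have "?xy x y / ?p y = inverse (?n y)" using xy[OF that] by (simp add: field_simps)
    then show ?thesis using xy[OF that] n[of y] by (simp add: log_inverse)
  qed (use xy[OF that] in simp)
  have "\<H>(X | Y) = (\<Sum>(x, y)\<in>?I. ?p y / ?n y * log b (?n y))"
    unfolding conditional_entropy_sum[OF X' Y]
    by (rule sum.cong[OF refl]) (use X UC summand in auto)
  also have "\<dots> = (\<Sum>(y, x)\<in>(\<lambda>\<omega>. (Y \<omega>, X \<omega>)) ` space M. ?p y / ?n y * log b (?n y))"
    by (rule sum.reindex_bij_witness[of _ prod.swap prod.swap]) auto
  \<comment> \<open>\<open>?J\<close> may contain pairs that never occur, since a value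
    \<open>y\<close> of probability zero need not meet every \<open>u\<close> in \<open>C\<close>.
    Their terms vanish.\<close>
  also have "\<dots> = (\<Sum>(y, x)\<in>?J. ?p y / ?n y * log b (?n y))"
  proof (rule sum.mono_neutral_left)
    show "finite ?J" using finY C by auto
    show "(\<lambda>\<omega>. (Y \<omega>, X \<omega>)) ` space M \<subseteq> ?J" using X UC by auto
    show "\<forall>p\<in>?J - (\<lambda>\<omega>. (Y \<omega>, X \<omega>)) ` space M. (case p of (y, x) \<Rightarrow> ?p y / ?n y * log b (?n y)) = 0"
    proof clarify
      fix y x assume yx: "y \<in> space M" "x \<in> C"
        and no: "(Y y, f (Y y) x) \<notin> (\<lambda>\<omega>. (Y \<omega>, X \<omega>)) ` space M"
      then have "{\<omega>\<in>space M. X \<omega> = f (Y y) x \<and> Y \<omega> = Y y} = {}" by (force simp: image_iff)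
      then have "?p (Y y) / ?n (Y y) = 0"
        using xy[of "Y y" "f (Y y) x"] yx by (metis imageI measure_empty)
      then show "?p (Y y) / ?n (Y y) * log b (?n (Y y)) = 0" by (simp only: mult_zero_left)
    qed
  qed
  also have "\<dots> = (\<Sum>y\<in>Y ` space M. \<Sum>x\<in>f y ` C. ?p y / ?n y * log b (?n y))"
    using finY C by (subst sum.Sigma) auto
  also have "\<dots> = (\<Sum>y\<in>Y ` space M. ?p y * log b (?n y))"
    using n by (intro sum.cong refl) (simp add: less_imp_neq[symmetric])
  also have "\<dots> = expectation (\<lambda>\<omega>. log b (?n (Y \<omega>)))"
    unfolding expectation_simple(2)[OF Y, of "\<lambda>y. log b (?n y)"]
    by (intro sum.cong refl arg_cong2[where f = "(*)"] arg_cong[where f = prob]) auto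
  finally show ?thesis .
qed

section \<open>The scheme in terms of message symbols\<close>

lemma pick_atLeastLessThan:
  assumes "i < e - s"
  shows "pick {s..<e} i = s + i"
proof -
  have "{a \<in> {s..<e}. a < s + i} = {s..<s + i}" using assms by auto
  then show ?thesis using pick_card_in_set[of "s + i" "{s..<e}"] assms by simp
qed

lemma response_eq_col_mult:
  assumes A: "dim_col A = M * L"
    and w: "\<And>k. k \<in> {1..M} \<Longrightarrow> w k = vec L (\<lambda>i. u ((k - 1) * L + i))"
  shows "response M L A w = col_mult A {..<M * L} u"
proof -
  have part: "query_part L {k} A *\<^sub>v w k = col_mult A {(k - 1) * L..<k * L} u"
    if k: "k \<in> {1..M}" for k
  proof -
    let ?K = "{(k - 1) * L..<k * L}"
    have card: "card ?K = L" using k by (cases k) auto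
    have sub: "?K \<subseteq> {..<dim_col A}"
      using block_cols_subset[of "{k}" M L] k A by (simp add: block_cols_def)
    have "w k = vec (card ?K) (\<lambda>i. u (pick ?K i))"
      unfolding w[OF k] card using card by (intro eq_vecI) (auto simp: pick_atLeastLessThan)
    then show ?thesis using submatrix_mult_vec[OF sub, of u] by (simp add: query_part_def)
  qed
  show ?thesis
  proof (rule eq_vecI)
    have closed: "(\<lambda>k. query_part L {k} A *\<^sub>v w k) \<in> {1..M} \<rightarrow> carrier_vec (dim_row A)"
      using part by (auto simp: col_mult_def)
    then have "response M L A w \<in> carrier_vec (dim_row A)"
      unfolding response_def by (rule finsum_vec_closed)
    then show "dim_vec (response M L A w) = dim_vec (col_mult A {..<M * L} u)"
      by (simp add: col_mult_def)
    fix i assume "i < dim_vec (col_mult A {..<M * L} u)"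
    then have i: "i < dim_row A" by (simp add: col_mult_def)
    let ?f = "\<lambda>c. A $$ (i, c) * u c"
    have "response M L A w $ i = (\<Sum>k\<in>{1..M}. (query_part L {k} A *\<^sub>v w k) $ i)"
      unfolding response_def by (rule index_finsum_vec[OF _ i closed]) simp
    also have "\<dots> = (\<Sum>k\<in>{1..M}. sum ?f {(k - 1) * L..<k * L})"
      using part i by (intro sum.cong) (auto simp: col_mult_def)
    \<comment> \<open>Messages are numbered from 1, so the index is shifted by one before the
      consecutive blocks are merged into one sum.\<close>
    also have "\<dots> = (\<Sum>k<M. sum ?f {k * L..<k * L + L})"
      by (simp add: sum.atLeast1_atMost_eq add.commute)
    also have "\<dots> = sum ?f {..<M * L}" by (rule sum.nat_group)
    finally show "response M L A w $ i = col_mult A {..<M * L} u $ i"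
      using i by (simp add: col_mult_def)
  qed
qed

text \<open>Translation by the difference of two preimages maps one fibre injectively into the
  other. By symmetry all fibres over the image have the same size.\<close>

lemma card_fibre_col_mult:
  fixes A :: "'a::{ring,finite} mat"
  assumes K: "finite K" and x: "x \<in> col_mult A K ` PiE K (\<lambda>_. UNIV)"
  shows "card {u \<in> PiE K (\<lambda>_. UNIV). col_mult A K u = x} * card (col_mult A K ` PiE K (\<lambda>_. UNIV))
    = card (PiE K (\<lambda>_. UNIV :: 'a set))"
proof -
  let ?C = "PiE K (\<lambda>_. UNIV :: 'a set)"
  let ?F = "\<lambda>x. {u \<in> ?C. col_mult A K u = x}"
  have finC: "finite ?C" using K by (simp add: finite_PiE)
  have le: "card (?F x) \<le> card (?F y)" if x: "x \<in> col_mult A K ` ?C" and y: "y \<in> col_mult A K ` ?C" for x y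
  proof -
    obtain a where a: "a \<in> ?C" "x = col_mult A K a" using x by blast
    obtain b where b: "b \<in> ?C" "y = col_mult A K b" using y by blast
    let ?t = "\<lambda>u. \<lambda>c\<in>K. u c - a c + b c"
    have "?t ` ?F x \<subseteq> ?F y"
    proof clarify
      fix u assume u: "u \<in> ?C" "x = col_mult A K u"
      have "(\<Sum>c\<in>K. A $$ (i, c) * ?t u c) = (\<Sum>c\<in>K. A $$ (i, c) * u c)
          - (\<Sum>c\<in>K. A $$ (i, c) * a c) + (\<Sum>c\<in>K. A $$ (i, c) * b c)" for i
        by (simp add: algebra_simps sum.distrib sum_subtractf)
      then have "col_mult A K (?t u) = y"
        using u(2) unfolding a(2) b(2) col_mult_eq_iff by simp
      then show "?t u \<in> ?C \<and> col_mult A K (?t u) = y" by auto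
    qed
    moreover have "inj_on ?t (?F x)"
    proof (rule inj_onI)
      fix u v assume u: "u \<in> ?F x" and v: "v \<in> ?F x" and eq: "?t u = ?t v"
      have "u c = v c" if "c \<in> K" for c
        using fun_cong[OF eq, of c] that by simp
      then show "u = v" using u v by (auto intro: PiE_ext)
    qed
    ultimately show ?thesis
      using card_mono[of "?F y" "?t ` ?F x"] finC by (simp add: card_image)
  qed
  have "card ?C = (\<Sum>y\<in>col_mult A K ` ?C. card (?F y))"
    unfolding card_eq_sum by (rule sum.image_gen[OF finC])
  also have "\<dots> = (\<Sum>y\<in>col_mult A K ` ?C. card (?F x))"
    by (rule sum.cong[OF refl], rule antisym) (erule le[OF _ x] le[OF x])+
  finally show ?thesis by simp
qed

lemma image_col_mult_PiE: "col_mult A K ` PiE K (\<lambda>_. UNIV) = range (col_mult A K)"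
proof (intro equalityI subsetI)
  fix y assume "y \<in> range (col_mult A K)"
  then obtain u where "y = col_mult A K u" by blast
  then have "y = col_mult A K (restrict u K)"
    using col_mult_cong[of K u "restrict u K" A] by simp
  then show "y \<in> col_mult A K ` PiE K (\<lambda>_. UNIV)"
    by (rule image_eqI[where f = "col_mult A K"]) simp
qed auto

lemma block_cols_all: "block_cols L {1..M} = {..<M * L}"
  by (intro card_subset_eq block_cols_subset) (auto simp: card_block_cols)

lemma symbol_index:
  fixes k L i :: nat
  assumes "i < L" "k \<ge> 1"
  shows "((k - 1) * L + i) div L + 1 = k" "((k - 1) * L + i) mod L = i"
  using assms by (auto simp: div_mult_self3)

lemma symbol_index_inverse:
  fixes c M L :: nat
  assumes "c < M * L"
  shows "c div L + 1 \<in> {1..M}" "c mod L < L" "(c div L + 1 - 1) * L + c mod L = c"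
proof -
  show "c div L + 1 \<in> {1..M}" using less_mult_imp_div_less[OF assms] by simp
  show "c mod L < L" using assms by (cases "L = 0") auto
qed simp

context linear_pir_scheme
begin

text \<open>The restriction to \<open>{1..S}\<close> matches the independence assumption of the
  scheme and leaves finitely many values.\<close>

definition queries :: "nat \<Rightarrow> 'w \<Rightarrow> nat \<Rightarrow> 'a mat" where
  "queries m \<omega> = (\<lambda>j\<in>{1..S}. Q m j \<omega>)"

text \<open>Column \<open>c\<close> belongs to entry \<open>c mod L\<close> of message
  \<open>c div L + 1\<close>. All messages become one extensional function, which ranges over a
  finite set.\<close>

definition symbols :: "'w \<Rightarrow> nat \<Rightarrow> 'a" where
  "symbols \<omega> = (\<lambda>c\<in>{..<M * L}. W (c div L + 1) \<omega> $ (c mod L))"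

abbreviation symbol_space :: "(nat \<Rightarrow> 'a) set" where
  "symbol_space \<equiv> PiE {..<M * L} (\<lambda>_. UNIV)"

lemma information_space: "information_space \<Omega> (real CARD('a))"
  using card_field_gt_1[where 'a = 'a] by unfold_locales simp

lemma symbols_in_space: "symbols \<omega> \<in> symbol_space"
  by (simp add: symbols_def)

lemma messages_carrier: "k \<in> {1..M} \<Longrightarrow> \<omega> \<in> space \<Omega> \<Longrightarrow> W k \<omega> \<in> carrier_vec L"
  using messages_independent by (auto simp: indep_vars_def2 measurable_def)

lemma message_eq_symbols:
  assumes "k \<in> {1..M}" "\<omega> \<in> space \<Omega>"
  shows "W k \<omega> = vec L (\<lambda>i. symbols \<omega> ((k - 1) * L + i))"
proof (rule eq_vecI)
  fix i assume "i < dim_vec (vec L (\<lambda>i. symbols \<omega> ((k - 1) * L + i)))"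
  then have i: "i < L" by simp
  have "(k - 1) * L + i < (k - 1) * L + L" using i by simp
  also have "\<dots> = k * L" using assms(1) by (cases k) auto
  also have "\<dots> \<le> M * L" using assms(1) by (intro mult_right_mono) auto
  finally show "W k \<omega> $ i = vec L (\<lambda>i. symbols \<omega> ((k - 1) * L + i)) $ i"
    using i assms(1) symbol_index[of i L k] by (simp add: symbols_def)
qed (use messages_carrier[OF assms] in auto)

lemma symbols_eq_iff:
  assumes "u \<in> symbol_space" "\<omega> \<in> space \<Omega>"
  shows "symbols \<omega> = u \<longleftrightarrow> (\<forall>k\<in>{1..M}. W k \<omega> = vec L (\<lambda>i. u ((k - 1) * L + i)))"
proof
  assume "\<forall>k\<in>{1..M}. W k \<omega> = vec L (\<lambda>i. u ((k - 1) * L + i))"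
  then have "symbols \<omega> c = u c" if "c < M * L" for c
    using symbol_index_inverse[OF that] that by (simp add: symbols_def)
  then show "symbols \<omega> = u"
    by (intro PiE_ext[OF symbols_in_space assms(1)]) auto
qed (use message_eq_symbols[OF _ assms(2)] in auto)

lemma prob_message:
  assumes "k \<in> {1..M}" "w \<in> carrier_vec L"
  shows "W k -` {w} \<inter> space \<Omega> \<in> events" "prob (W k -` {w} \<inter> space \<Omega>) = 1 / CARD('a) ^ L"
proof -
  have meas: "W k \<in> measurable \<Omega> (count_space (carrier_vec L))"
    using messages_independent assms(1) by (auto simp: indep_vars_def2)
  then show "W k -` {w} \<inter> space \<Omega> \<in> events"
    using assms(2) by (auto intro: measurable_sets)
  have "prob (W k -` {w} \<inter> space \<Omega>) = measure (uniform_count_measure (carrier_vec L)) {w}"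
    using assms meas by (simp add: messages_uniform[symmetric] measure_distr)
  then show "prob (W k -` {w} \<inter> space \<Omega>) = 1 / CARD('a) ^ L"
    using assms(2) by (simp add: measure_uniform_count_measure card_carrier_vec)
qed

lemma symbols_event:
  assumes "M \<ge> 1" "u \<in> symbol_space"
  shows "{\<omega>\<in>space \<Omega>. symbols \<omega> = u} \<in> events"
    and "prob {\<omega>\<in>space \<Omega>. symbols \<omega> = u} = 1 / card (symbol_space :: (nat \<Rightarrow> 'a) set)"
proof -
  let ?E = "\<lambda>k. W k -` {vec L (\<lambda>i. u ((k - 1) * L + i))} \<inter> space \<Omega>"
  have ne: "{1..M} \<noteq> {}" using assms(1) by simp
  have eq: "{\<omega>\<in>space \<Omega>. symbols \<omega> = u} = (\<Inter>k\<in>{1..M}. ?E k)"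
    using ne symbols_eq_iff[OF assms(2)] by auto
  show "{\<omega>\<in>space \<Omega>. symbols \<omega> = u} \<in> events"
    unfolding eq using ne by (intro sets.finite_INT prob_message) auto
  have "prob (\<Inter>k\<in>{1..M}. ?E k) = (\<Prod>k\<in>{1..M}. prob (?E k))"
  proof (rule indep_setsD[OF messages_independent[unfolded indep_vars_def2, THEN conjunct2]
        order.refl ne finite_atLeastAtMost], rule ballI)
    fix k
    show "?E k \<in> {W k -` A \<inter> space \<Omega> | A. A \<in> sets (count_space (carrier_vec L))}"
      by (rule CollectI, rule exI[of _ "{vec L (\<lambda>i. u ((k - 1) * L + i))}"]) simp
  qed
  also have "\<dots> = (\<Prod>k\<in>{1..M}. 1 / CARD('a) ^ L)"
    by (intro prod.cong refl prob_message) auto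
  also have "\<dots> = 1 / card (symbol_space :: (nat \<Rightarrow> 'a) set)"
    by (simp add: card_funcsetE power_one_over power_mult[symmetric] mult.commute)
  finally show "prob {\<omega>\<in>space \<Omega>. symbols \<omega> = u} = 1 / card (symbol_space :: (nat \<Rightarrow> 'a) set)" unfolding eq .
qed

lemma simple_function_symbols:
  assumes "M \<ge> 1"
  shows "simple_function \<Omega> symbols"
proof -
  have "symbols ` space \<Omega> \<subseteq> symbol_space" using symbols_in_space by (rule image_subsetI)
  then have "finite (symbols ` space \<Omega>)" by (rule finite_subset) (simp add: finite_PiE)
  moreover have "symbols -` {u} \<inter> space \<Omega> \<in> events" if "u \<in> symbols ` space \<Omega>" for u
    using symbols_event(1)[OF assms, of u] that symbols_in_space
    by (auto simp: vimage_def Int_def conj_commute simp del: PiE_iff)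
  ultimately show ?thesis by (simp add: simple_function_def)
qed

lemma simple_function_queries:
  assumes "m \<in> {1..M}"
  shows "simple_function \<Omega> (queries m)"
proof -
  have "finite (queries m ` space \<Omega>)"
  proof (rule finite_subset)
    show "queries m ` space \<Omega> \<subseteq> PiE {1..S} (\<lambda>j. Q m j ` space \<Omega>)" by (auto simp: queries_def)
    show "finite (PiE {1..S} (\<lambda>j. Q m j ` space \<Omega>))"
      by (intro finite_PiE finite_atLeastAtMost simple_functionD(1)[OF queries_finite[OF assms]])
  qed
  moreover have "queries m -` {r} \<inter> space \<Omega> \<in> events" for r
  proof -
    have "range (\<lambda>A. (\<lambda>\<omega>. \<lambda>j\<in>{1..S}. Q m j \<omega>) -` A \<inter> space \<Omega>) \<subseteq> events"
      using queries_independent_of_messages[OF assms] by (rule indep_setD_ev1)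
    then show ?thesis unfolding queries_def[abs_def] by blast
  qed
  ultimately show ?thesis by (simp add: simple_function_def)
qed

text \<open>Stated for a set \<open>T\<close> of query families so that it serves both for the query
  of a single server, with \<open>{r. r j = A}\<close>, and for a complete realization, with
  \<open>{r}\<close>.\<close>

lemma prob_queries_symbols:
  assumes "m \<in> {1..M}" "u \<in> symbol_space"
  shows "prob {\<omega>\<in>space \<Omega>. queries m \<omega> \<in> T \<and> symbols \<omega> = u} =
    prob {\<omega>\<in>space \<Omega>. queries m \<omega> \<in> T} / card (symbol_space :: (nat \<Rightarrow> 'a) set)"
proof -
  let ?B = "{w. \<forall>k\<in>{1..M}. w k = vec L (\<lambda>i. u ((k - 1) * L + i))}"
  have M: "M \<ge> 1" using assms(1) by auto
  have q: "(\<lambda>\<omega>. \<lambda>j\<in>{1..S}. Q m j \<omega>) -` T \<inter> space \<Omega> = {\<omega>\<in>space \<Omega>. queries m \<omega> \<in> T}"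
    by (auto simp: queries_def)
  have s: "(\<lambda>\<omega>. \<lambda>k\<in>{1..M}. W k \<omega>) -` ?B \<inter> space \<Omega> = {\<omega>\<in>space \<Omega>. symbols \<omega> = u}"
    using symbols_eq_iff[OF assms(2)] by auto
  have "prob ({\<omega>\<in>space \<Omega>. queries m \<omega> \<in> T} \<inter> {\<omega>\<in>space \<Omega>. symbols \<omega> = u}) =
      prob {\<omega>\<in>space \<Omega>. queries m \<omega> \<in> T} * prob {\<omega>\<in>space \<Omega>. symbols \<omega> = u}"
    using indep_setD[OF queries_independent_of_messages[OF assms(1)] rangeI[of _ T] rangeI[of _ ?B]]
    unfolding q s .
  moreover have "{\<omega>\<in>space \<Omega>. queries m \<omega> \<in> T \<and> symbols \<omega> = u} =
      {\<omega>\<in>space \<Omega>. queries m \<omega> \<in> T} \<inter> {\<omega>\<in>space \<Omega>. symbols \<omega> = u}" by auto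
  ultimately show ?thesis using symbols_event(2)[OF M assms(2)] by simp
qed

lemma response_eq:
  assumes "m \<in> {1..M}" "j \<in> {1..S}" "\<omega> \<in> space \<Omega>"
  shows "pir_response M L W Q m j \<omega> = col_mult (Q m j \<omega>) {..<M * L} (symbols \<omega>)"
  unfolding pir_response_def
  by (rule response_eq_col_mult[OF queries_columns[OF assms]])
    (use message_eq_symbols[OF _ assms(3)] in simp)

end

text \<open>The difference of the expectations is a sum of nonnegative terms weighted by the
  probabilities of the values of \<open>Y\<close>. It vanishes only if equality holds at every value
  of positive probability; this is how an identity of expectations becomes one for all
  realizations.\<close>

lemma (in prob_space) expectation_simple_mono:
  fixes f g :: "'b \<Rightarrow> real"
  assumes Y: "simple_function M Y"
    and le: "\<And>y. prob (Y -` {y} \<inter> space M) > 0 \<Longrightarrow> f y \<le> g y"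
  shows "expectation (\<lambda>\<omega>. f (Y \<omega>)) \<le> expectation (\<lambda>\<omega>. g (Y \<omega>))"
    and "expectation (\<lambda>\<omega>. f (Y \<omega>)) = expectation (\<lambda>\<omega>. g (Y \<omega>)) \<longleftrightarrow>
      (\<forall>y. prob (Y -` {y} \<inter> space M) > 0 \<longrightarrow> f y = g y)"
proof -
  let ?p = "\<lambda>y. prob (Y -` {y} \<inter> space M)"
  let ?I = "Y ` space M"
  have diff: "expectation (\<lambda>\<omega>. g (Y \<omega>)) - expectation (\<lambda>\<omega>. f (Y \<omega>)) = (\<Sum>y\<in>?I. ?p y * (g y - f y))"
    by (simp add: expectation_simple(2)[OF Y] sum_subtractf right_diff_distrib)
  have nonneg: "?p y * (g y - f y) \<ge> 0" for y
    using le[of y] by (cases "?p y = 0") (auto simp: zero_less_measure_iff)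
  then show "expectation (\<lambda>\<omega>. f (Y \<omega>)) \<le> expectation (\<lambda>\<omega>. g (Y \<omega>))"
    using diff sum_nonneg[of ?I "\<lambda>y. ?p y * (g y - f y)"] by simp
  have "expectation (\<lambda>\<omega>. f (Y \<omega>)) = expectation (\<lambda>\<omega>. g (Y \<omega>)) \<longleftrightarrow>
      (\<forall>y\<in>?I. ?p y * (g y - f y) = 0)"
    using diff sum_nonneg_eq_0_iff[OF simple_functionD(1)[OF Y], of "\<lambda>y. ?p y * (g y - f y)"] nonneg
    by auto
  also have "\<dots> \<longleftrightarrow> (\<forall>y. ?p y > 0 \<longrightarrow> f y = g y)"
  proof -
    have "?p y = 0" if "y \<notin> ?I" for y
    proof -
      have "Y -` {y} \<inter> space M = {}" using that by auto
      then show ?thesis by (simp only: measure_empty)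
    qed
    then show ?thesis
      by (metis diff_eq_diff_eq eq_iff_diff_eq_0 less_irrefl mult_eq_0_iff zero_less_measure_iff)
  qed
  finally show "expectation (\<lambda>\<omega>. f (Y \<omega>)) = expectation (\<lambda>\<omega>. g (Y \<omega>)) \<longleftrightarrow>
      (\<forall>y. ?p y > 0 \<longrightarrow> f y = g y)" .
qed

section \<open>Entropies of messages and responses, and decoding for single realizations\<close>

context linear_pir_scheme
begin

lemma simple_function_message:
  assumes "M \<ge> 1" "k \<in> {1..M}"
  shows "simple_function \<Omega> (W k)"
  using simple_function_compose[OF simple_function_symbols[OF assms(1)],
      of "\<lambda>u. vec L (\<lambda>i. u ((k - 1) * L + i))"] message_eq_symbols[OF assms(2)]
  by (simp add: comp_def cong: simple_function_cong)

lemma entropy_message: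
  assumes "M \<ge> 1" "k \<in> {1..M}"
  shows "entropy_of (real CARD('a)) \<Omega> (W k) = real L"
proof -
  interpret information_space \<Omega> "real CARD('a)" by (rule information_space)
  have q: "1 < real CARD('a)" by (rule b_gt_1)
  have pos: "W k -` {w} \<inter> space \<Omega> \<noteq> {}" if "w \<in> carrier_vec L" for w
  proof
    assume "W k -` {w} \<inter> space \<Omega> = {}"
    then have "prob (W k -` {w} \<inter> space \<Omega>) = 0" by (simp only: measure_empty)
    then show False using prob_message(2)[OF assms(2) that] q by simp
  qed
  have img: "W k ` space \<Omega> = carrier_vec L"
    using messages_carrier[OF assms(2)] pos by blast
  have "simple_distributed \<Omega> (W k) (\<lambda>_. 1 / CARD('a) ^ L)"
    using prob_message(2)[OF assms(2)] img
    by (intro simple_distributedI simple_function_message assms) auto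
  then have "entropy_of (real CARD('a)) \<Omega> (W k) =
      - (\<Sum>x\<in>(carrier_vec L :: 'a Matrix.vec set). 1 / CARD('a) ^ L * log CARD('a) (1 / CARD('a) ^ L))"
    using entropy_simple_distributed[of "W k"] by (simp only: entropy_of_def img)
  also have "\<dots> = L"
    using q by (simp add: card_carrier_vec log_divide log_nat_power)
  finally show ?thesis .
qed

text \<open>Given the query, the response is a linear image of the uniform symbols, so its entropy
  is the logarithm of the size of the range, to base \<open>CARD('a)\<close>.\<close>

lemma cond_entropy_response:
  assumes m: "m \<in> {1..M}" and j: "j \<in> {1..S}"
  shows "cond_entropy_of (real CARD('a)) \<Omega> (pir_response M L W Q m j) (Q m j) =
    expectation (\<lambda>\<omega>. real (query_rank L {1..M} (Q m j \<omega>)))"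
proof -
  interpret information_space \<Omega> "real CARD('a)" by (rule information_space)
  have q: "1 < real CARD('a)" by (rule b_gt_1)
  have M: "M \<ge> 1" using m by auto
  let ?f = "\<lambda>A. col_mult A {..<M * L}"
  have Qj: "queries m \<omega> j = Q m j \<omega>" for \<omega> using j by (simp add: queries_def)
  have "cond_entropy_of (real CARD('a)) \<Omega> (pir_response M L W Q m j) (Q m j) =
      expectation (\<lambda>\<omega>. log CARD('a) (card (?f (Q m j \<omega>) ` symbol_space)))"
    unfolding cond_entropy_of_def
  proof (rule conditional_entropy_uniform_fibres[where U = symbols])
    show "simple_function \<Omega> (Q m j)" using m j by (rule queries_finite)
    show "simple_function \<Omega> symbols" using M by (rule simple_function_symbols)
    show "finite (symbol_space :: (nat \<Rightarrow> 'a) set)" by (simp add: finite_PiE)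
    show "symbols \<omega> \<in> symbol_space" for \<omega> by (rule symbols_in_space)
    show "pir_response M L W Q m j \<omega> = ?f (Q m j \<omega>) (symbols \<omega>)" if "\<omega> \<in> space \<Omega>" for \<omega>
      using m j that by (rule response_eq)
    show "prob {\<omega> \<in> space \<Omega>. Q m j \<omega> = A \<and> symbols \<omega> = u} =
        prob {\<omega> \<in> space \<Omega>. Q m j \<omega> = A} / card (symbol_space :: (nat \<Rightarrow> 'a) set)"
      if "u \<in> symbol_space" for A u
      using prob_queries_symbols[OF m that, of "{r. r j = A}"] by (simp add: Qj)
    show "card {u \<in> symbol_space. ?f A u = x} * card (?f A ` symbol_space) = card (symbol_space :: (nat \<Rightarrow> 'a) set)"
      if "x \<in> ?f A ` symbol_space" for A :: "'a mat" and x
      using card_fibre_col_mult[OF finite_lessThan that] .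
  qed
  also have "\<dots> = expectation (\<lambda>\<omega>. real (query_rank L {1..M} (Q m j \<omega>)))"
  proof (rule Bochner_Integration.integral_cong[OF refl])
    fix \<omega> assume \<omega>: "\<omega> \<in> space \<Omega>"
    have "{..<M * L} \<subseteq> {..<dim_col (Q m j \<omega>)}" using queries_columns[OF m j \<omega>] by simp
    from card_range_col_mult[OF this]
    have "card (?f (Q m j \<omega>) ` symbol_space) = CARD('a) ^ query_rank L {1..M} (Q m j \<omega>)"
      unfolding image_col_mult_PiE
      unfolding query_rank_def query_part_def block_cols_def[symmetric] block_cols_all .
    then show "log CARD('a) (card (?f (Q m j \<omega>) ` symbol_space)) = real (query_rank L {1..M} (Q m j \<omega>))"
      using q by (simp add: log_nat_power)
  qed
  finally show ?thesis .
qed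

lemma restrict_eq_iff: "restrict f A = restrict g A \<longleftrightarrow> (\<forall>x\<in>A. f x = g x)"
  by (auto simp: restrict_def fun_eq_iff)

lemma possible_queries_iff:
  "q \<in> possible_queries \<Omega> S Q m \<longleftrightarrow>
    prob (queries m -` {restrict q {1..S}} \<inter> space \<Omega>) > 0"
proof -
  have "{\<omega> \<in> space \<Omega>. \<forall>j\<in>{1..S}. Q m j \<omega> = q j} = queries m -` {restrict q {1..S}} \<inter> space \<Omega>"
    by (simp add: queries_def restrict_eq_iff vimage_def Int_def conj_commute)
  then show ?thesis by (simp add: possible_queries_def)
qed

text \<open>\<open>possible_queries\<close> contains families with arbitrary entries outside
  \<open>{1..S}\<close>, whereas \<open>queries m\<close> takes only extensional values. The
  hypothesis says that \<open>P\<close> ignores this difference.\<close>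

lemma all_possible_queries_iff:
  assumes "\<And>q. P (restrict q {1..S}) \<longleftrightarrow> P q"
  shows "(\<forall>y. prob (queries m -` {y} \<inter> space \<Omega>) > 0 \<longrightarrow> P y) \<longleftrightarrow>
    (\<forall>q\<in>possible_queries \<Omega> S Q m. P q)"
proof -
  have "y \<in> possible_queries \<Omega> S Q m" if "prob (queries m -` {y} \<inter> space \<Omega>) > 0" for y
  proof -
    have "queries m -` {y} \<inter> space \<Omega> \<noteq> {}"
      using that by (metis less_irrefl measure_empty)
    then have "restrict y {1..S} = y" by (auto simp: queries_def)
    then show ?thesis using that by (simp add: possible_queries_iff)
  qed
  moreover have "prob (queries m -` {restrict q {1..S}} \<inter> space \<Omega>) > 0"
    if "q \<in> possible_queries \<Omega> S Q m" for q
    using that by (simp only: possible_queries_iff)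
  ultimately show ?thesis using assms by blast
qed

lemma query_family_possible:
  assumes "m \<in> {1..M}" "q \<in> possible_queries \<Omega> S Q m"
  shows "query_family M S L q"
proof
  fix j assume j: "j \<in> {1..S}"
  have "prob (queries m -` {restrict q {1..S}} \<inter> space \<Omega>) \<noteq> 0"
    using assms(2) by (simp only: possible_queries_iff less_irrefl)
  then have "queries m -` {restrict q {1..S}} \<inter> space \<Omega> \<noteq> {}"
    by (metis measure_empty)
  then obtain \<omega> where \<omega>: "\<omega> \<in> space \<Omega>" "queries m \<omega> = restrict q {1..S}" by auto
  from fun_cong[OF this(2), of j] j have "Q m j \<omega> = q j" by (simp add: queries_def)
  with \<omega>(1) show "dim_col (q j) = M * L" using queries_columns[OF assms(1) j] by metis
qed

text \<open>Suppose two words give the same answers to \<open>q\<close> but differ in message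
  \<open>m\<close>. Both occur together with \<open>q\<close> with positive probability, so one
  value of answers and queries is compatible with two values of \<open>W m\<close>, contradicting
  zero conditional entropy.\<close>

lemma decodes_possible:
  assumes cor: "pir_correct \<Omega> M S L W Q" and m: "m \<in> {1..M}"
    and q: "q \<in> possible_queries \<Omega> S Q m"
  shows "decodes M S L q m"
  unfolding decodes_def
proof (intro allI impI ballI, rule ccontr)
  interpret information_space \<Omega> "real CARD('a)" by (rule information_space)
  fix u u' c
  assume eq: "joint_mult S q {..<M * L} u = joint_mult S q {..<M * L} u'"
    and c: "c \<in> block_cols L {m}" and neq: "u c \<noteq> u' c"
  have M: "M \<ge> 1" using m by auto
  define r where "r = restrict q {1..S}"
  define v where "v = restrict u {..<M * L}"
  define v' where "v' = restrict u' {..<M * L}"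
  have v: "v \<in> symbol_space" "v' \<in> symbol_space" by (auto simp: v_def v'_def)
  have cM: "c < M * L" using block_cols_subset[of "{m}" M L] m c by auto
  have cong: "joint_mult S r {..<M * L} (restrict u {..<M * L}) = joint_mult S q {..<M * L} u" for u
    unfolding joint_mult_def r_def
    by (rule restrict_ext) (auto intro: col_mult_cong)
  let ?h = "\<lambda>(r, u). (joint_mult S r {..<M * L} u, r)"
  define Y where "Y = (\<lambda>\<omega>. (\<lambda>j\<in>{1..S}. pir_response M L W Q m j \<omega>, \<lambda>j\<in>{1..S}. Q m j \<omega>))"
  have Y_eq: "Y \<omega> = ?h (queries m \<omega>, symbols \<omega>)" if "\<omega> \<in> space \<Omega>" for \<omega>
    unfolding Y_def joint_mult_def prod.case
    using response_eq[OF m _ that] by (auto simp: queries_def intro!: restrict_ext)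
  have sQU: "simple_function \<Omega> (\<lambda>\<omega>. (queries m \<omega>, symbols \<omega>))"
    by (intro simple_function_Pair simple_function_queries simple_function_symbols m M)
  have sY: "simple_function \<Omega> Y"
    using simple_function_compose[OF sQU, of ?h] Y_eq
    by (simp add: comp_def cong: simple_function_cong)
  have sW: "simple_function \<Omega> (W m)" by (rule simple_function_message[OF M m])
  define x where "x = vec L (\<lambda>i. v ((m - 1) * L + i))"
  let ?y = "?h (r, v)"
  let ?E = "\<lambda>v. {\<omega> \<in> space \<Omega>. queries m \<omega> \<in> {r} \<and> symbols \<omega> = v}"
  have "queries m -` {r} \<inter> space \<Omega> = {\<omega> \<in> space \<Omega>. queries m \<omega> \<in> {r}}" by auto
  then have "prob {\<omega> \<in> space \<Omega>. queries m \<omega> \<in> {r}} > 0"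
    using q unfolding possible_queries_iff r_def by simp
  moreover have "card (symbol_space :: (nat \<Rightarrow> 'a) set) > 0"
    using v by (auto simp: card_gt_0_iff finite_PiE)
  ultimately have pos: "prob (?E w) > 0" if "w \<in> symbol_space" for w
    using prob_queries_symbols[OF m that, of "{r}"] by simp
  have evE: "?E w \<in> events" for w
    using simple_functionD(2)[OF sQU, of "{(r, w)}"] by (simp add: vimage_def Int_def conj_commute)
  have evY: "{\<omega>\<in>space \<Omega>. Y \<omega> = ?y} \<in> events"
    using simple_functionD(2)[OF sY, of "{?y}"] by (simp add: vimage_def Int_def conj_commute)
  have evXY: "{\<omega>\<in>space \<Omega>. W m \<omega> = x \<and> Y \<omega> = ?y} \<in> events"
    using simple_functionD(2)[OF simple_function_Pair[OF sW sY], of "{(x, ?y)}"]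
    by (simp add: vimage_def Int_def conj_commute)
  have "?E v \<subseteq> {\<omega>\<in>space \<Omega>. W m \<omega> = x \<and> Y \<omega> = ?y}"
    using Y_eq message_eq_symbols[OF m] by (auto simp: x_def)
  then have "prob {\<omega>\<in>space \<Omega>. W m \<omega> = x \<and> Y \<omega> = ?y} > 0"
    using pos[OF v(1)] finite_measure_mono[OF _ evXY] by (meson less_le_trans)
  moreover have "conditional_entropy (real CARD('a)) (count_space (W m ` space \<Omega>))
      (count_space (Y ` space \<Omega>)) (W m) Y = 0"
    using cor m unfolding pir_correct_def cond_entropy_of_def Y_def by blast
  ultimately have same: "prob {\<omega>\<in>space \<Omega>. Y \<omega> = ?y} = prob {\<omega>\<in>space \<Omega>. W m \<omega> = x \<and> Y \<omega> = ?y}"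
    by (intro conditional_entropy_eq_0_imp_determined[OF sW sY])
  have y': "?y = ?h (r, v')"
    using cong[of u] cong[of u'] eq by (simp add: v_def v'_def)
  have sub: "?E v' \<subseteq> {\<omega>\<in>space \<Omega>. Y \<omega> = ?y}"
    using Y_eq unfolding y' by auto
  have disj: "?E v' \<inter> {\<omega>\<in>space \<Omega>. W m \<omega> = x \<and> Y \<omega> = ?y} = {}"
  proof (intro equals0I, elim IntE CollectE conjE)
    fix \<omega> assume \<omega>: "\<omega> \<in> space \<Omega>" "symbols \<omega> = v'" "W m \<omega> = x"
    define i where "i = c - (m - 1) * L"
    have i: "i < L" "(m - 1) * L + i = c"
      using c m by (cases m; force simp: block_cols_def i_def)+
    have "v' c = W m \<omega> $ i"
      using message_eq_symbols[OF m \<omega>(1)] \<omega>(2) i by simp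
    also have "\<dots> = v c" using \<omega>(3) i by (simp add: x_def)
    finally show False using neq cM by (simp add: v_def v'_def)
  qed
  \<comment> \<open>Both events lie in \<open>Y = ?y\<close> and are disjoint, but the second
    already has the full probability of \<open>Y = ?y\<close>, while the first has positive
    probability.\<close>
  have "prob (?E v') + prob {\<omega>\<in>space \<Omega>. W m \<omega> = x \<and> Y \<omega> = ?y} =
      prob (?E v' \<union> {\<omega>\<in>space \<Omega>. W m \<omega> = x \<and> Y \<omega> = ?y})"
    by (rule finite_measure_Union[OF evE evXY disj, symmetric])
  also have "\<dots> \<le> prob {\<omega>\<in>space \<Omega>. Y \<omega> = ?y}"
    using sub by (intro finite_measure_mono evY) auto
  finally show False using same pos[OF v(2)] by linarith
qed

end

section \<open>The recursion for the expected ranks\<close>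

text \<open>With \<open>l = L\<close>, \<open>s = S\<close> and \<open>n = M\<close> this is the
  least possible expected download.\<close>

definition geometric_total :: "real \<Rightarrow> real \<Rightarrow> nat \<Rightarrow> real" where
  "geometric_total l s n = l * (\<Sum>i<n. (1 / s) ^ i)"

lemma geometric_total_Suc: "geometric_total l s (Suc n) = l + geometric_total l s n / s"
  by (simp add: geometric_total_def sum.lessThan_Suc_shift sum_divide_distrib[symmetric]
    distrib_left del: sum.lessThan_Suc)

lemma recursive_bound:
  fixes D :: "'k set \<Rightarrow> real"
  assumes "finite N" and s: "s > 0" and empty: "D {} = 0"
    and step: "\<And>J m. J \<subseteq> N \<Longrightarrow> m \<in> J \<Longrightarrow> D J \<ge> l + D (J - {m}) / s"
    and "J \<subseteq> N"
  shows "D J \<ge> geometric_total l s (card J)"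
  using finite_subset[OF \<open>J \<subseteq> N\<close> \<open>finite N\<close>] \<open>J \<subseteq> N\<close>
proof (induction J rule: finite_induct)
  case (insert m J)
  then have "geometric_total l s (card (insert m J)) = l + geometric_total l s (card J) / s"
    by (simp add: geometric_total_Suc)
  also have "\<dots> \<le> l + D (insert m J - {m}) / s"
    using insert s by (simp add: divide_right_mono)
  also have "\<dots> \<le> D (insert m J)" using insert.prems by (intro step) auto
  finally show ?case .
qed (simp add: empty geometric_total_def)

text \<open>Tightness at \<open>N\<close> descends to every subset by removing elements one at a
  time: the step inequality bounds the value at the smaller set from above, and
  \<open>recursive_bound\<close> bounds it from below. Once all values are tight, so are all
  steps.\<close>

lemma recursive_bound_tight_iff:
  fixes D :: "'k set \<Rightarrow> real"
  assumes N: "finite N" and s: "s > 0" and empty: "D {} = 0"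
    and step: "\<And>J m. J \<subseteq> N \<Longrightarrow> m \<in> J \<Longrightarrow> D J \<ge> l + D (J - {m}) / s"
  shows "D N = geometric_total l s (card N) \<longleftrightarrow>
    (\<forall>J\<subseteq>N. \<forall>m\<in>J. l + D (J - {m}) / s = D J)"
proof
  assume top: "D N = geometric_total l s (card N)"
  have tight: "D J = geometric_total l s (card J)" if "J \<subseteq> N" for J
  proof -
    have "D (N - K) = geometric_total l s (card (N - K))" if "K \<subseteq> N" for K
      using finite_subset[OF that N] that
    proof (induction K rule: finite_induct)
      case (insert m K)
      let ?J = "N - insert m K"
      have IH: "D (N - K) = geometric_total l s (card (N - K))" using insert by blast
      have J: "N - K = insert m ?J" "m \<notin> ?J" using insert by auto
      have card: "card (N - K) = Suc (card ?J)" unfolding J(1) using N by simp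
      have J': "N - K - {m} = ?J" "m \<in> N - K" using insert by auto
      have "l + D ?J / s \<le> D (N - K)"
        using step[of "N - K" m] J' by simp
      also have "\<dots> = l + geometric_total l s (card ?J) / s"
        unfolding IH card geometric_total_Suc ..
      finally have "D ?J \<le> geometric_total l s (card ?J)" using s by (simp add: divide_le_cancel)
      moreover have "D ?J \<ge> geometric_total l s (card ?J)"
        by (rule recursive_bound[where D = D, OF N s empty step Diff_subset])
      ultimately show ?case by simp
    qed (simp add: top)
    from this[of "N - J"] show ?thesis using that by (simp add: double_diff)
  qed
  show "\<forall>J\<subseteq>N. \<forall>m\<in>J. l + D (J - {m}) / s = D J"
  proof (intro allI impI ballI)
    fix J m assume J: "J \<subseteq> N" "m \<in> J"
    then have card: "card J = Suc (card (J - {m}))"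
      using finite_subset[OF J(1) N] by (metis card_Suc_Diff1)
    have "J - {m} \<subseteq> N" using J(1) by blast
    from tight[OF this] show "l + D (J - {m}) / s = D J"
      unfolding tight[OF J(1)] card geometric_total_Suc by (simp only:)
  qed
next
  assume eq: "\<forall>J\<subseteq>N. \<forall>m\<in>J. l + D (J - {m}) / s = D J"
  have "D J = geometric_total l s (card J)" if "J \<subseteq> N" for J
    using finite_subset[OF that N] that
  proof (induction J rule: finite_induct)
    case (insert m J)
    have "D (insert m J) = l + D (insert m J - {m}) / s"
      using eq insert.prems by (metis insertI1)
    then show ?case using insert by (simp add: geometric_total_Suc)
  qed (simp add: empty geometric_total_def)
  then show "D N = geometric_total l s (card N)" by blast
qed

section \<open>Expected ranks under privacy, and the rate\<close>

context linear_pir_scheme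
begin

definition total_rank :: "nat \<Rightarrow> nat set \<Rightarrow> real" where
  "total_rank m J = (\<Sum>j\<in>{1..S}. expectation (\<lambda>\<omega>. real (query_rank L J (Q m j \<omega>))))"

text \<open>Each summand is an expectation over the query of one server, so equal marginal laws
  suffice; the joint law of the queries may depend on the wanted message.\<close>

lemma total_rank_private:
  assumes "pir_private \<Omega> M S Q" "m \<in> {1..M}" "m' \<in> {1..M}"
  shows "total_rank m J = total_rank m' J"
  unfolding total_rank_def
proof (rule sum.cong[OF refl])
  fix j assume j: "j \<in> {1..S}"
  let ?g = "\<lambda>A. real (query_rank L J A)"
  have "expectation (\<lambda>\<omega>. ?g (Q m j \<omega>)) = integral\<^sup>L (distr \<Omega> (count_space UNIV) (Q m j)) ?g"
    if "m \<in> {1..M}" for m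
    by (rule integral_distr[symmetric])
      (use measurable_simple_function[OF queries_finite[OF that j]] in auto)
  then show "expectation (\<lambda>\<omega>. ?g (Q m j \<omega>)) = expectation (\<lambda>\<omega>. ?g (Q m' j \<omega>))"
    using assms j unfolding pir_private_def by metis
qed

lemma total_rank_eq:
  assumes "m \<in> {1..M}"
  shows "total_rank m J = expectation (\<lambda>\<omega>. \<Sum>j\<in>{1..S}. real (query_rank L J (queries m \<omega> j)))"
proof -
  have "(\<Sum>j\<in>{1..S}. real (query_rank L J (queries m \<omega> j))) =
      (\<Sum>j\<in>{1..S}. real (query_rank L J (Q m j \<omega>)))" for \<omega>
    by (rule sum.cong) (auto simp: queries_def)
  then show ?thesis
    unfolding total_rank_def
    by (simp only:) (intro Bochner_Integration.integral_sum[symmetric]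
      expectation_simple(1)[OF queries_finite[OF assms]])
qed

lemma total_rank_empty:
  assumes "m \<in> {1..M}"
  shows "total_rank m {} = 0"
proof -
  have "expectation (\<lambda>\<omega>. real (query_rank L {} (Q m j \<omega>))) = 0" if "j \<in> {1..S}" for j
  proof -
    have "query_rank L {} (Q m j \<omega>) = 0" if "\<omega> \<in> space \<Omega>" for \<omega>
    proof -
      interpret query_family M S L "\<lambda>j. Q m j \<omega>"
        using queries_columns[OF assms _ that] by unfold_locales
      show ?thesis using \<open>j \<in> {1..S}\<close> by (rule query_rank_empty)
    qed
    then show ?thesis by (simp cong: Bochner_Integration.integral_cong)
  qed
  then show ?thesis by (simp add: total_rank_def)
qed

text \<open>The rank equalities that make the recursion step from \<open>J\<close> to \<open>J - {m}\<close> an equality.\<close>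

definition tight :: "nat \<Rightarrow> nat set \<Rightarrow> bool" where
  "tight m J \<longleftrightarrow> (\<forall>q\<in>possible_queries \<Omega> S Q m.
     stacked_rank S L J q = (\<Sum>j\<in>{1..S}. query_rank L J (q j)) \<and>
     (\<forall>j\<in>{1..S}. stacked_rank S L (J - {m}) q = query_rank L (J - {m}) (q j)))"

text \<open>For each possible \<open>q\<close>, the number \<open>L\<close> plus the stacked rank on
  \<open>J - {m}\<close> separates \<open>f q\<close> from \<open>g q\<close>: the average over the
  servers is at most the stacked rank there, and the decoded stacked rank is at most the sum of the
  ranks on \<open>J\<close>. Hence \<open>f q = g q\<close> exactly when both comparisons are
  equalities.\<close>

lemma total_rank_step:
  assumes S: "S \<ge> 1" and cor: "pir_correct \<Omega> M S L W Q"
    and J: "J \<subseteq> {1..M}" "m \<in> J"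
  shows "real L + total_rank m (J - {m}) / S \<le> total_rank m J"
    and "real L + total_rank m (J - {m}) / S = total_rank m J \<longleftrightarrow> tight m J"
proof -
  have m: "m \<in> {1..M}" using J by blast
  let ?r = "\<lambda>J q j. real (query_rank L J (q j))"
  define f where "f = (\<lambda>q :: nat \<Rightarrow> 'a mat. real L + (\<Sum>j\<in>{1..S}. ?r (J - {m}) q j) / S)"
  define g where "g = (\<lambda>q :: nat \<Rightarrow> 'a mat. \<Sum>j\<in>{1..S}. ?r J q j)"
  have sQ: "simple_function \<Omega> (queries m)" using m by (rule simple_function_queries)
  have Ef: "real L + total_rank m (J - {m}) / S = expectation (\<lambda>\<omega>. f (queries m \<omega>))"
    using expectation_simple(1)[OF sQ, of "\<lambda>q. \<Sum>j\<in>{1..S}. ?r (J - {m}) q j"]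
    by (simp add: f_def total_rank_eq[OF m] prob_space)
  have Eg: "total_rank m J = expectation (\<lambda>\<omega>. g (queries m \<omega>))"
    by (simp add: g_def total_rank_eq[OF m])
  have bounds: "f q \<le> g q \<and> (f q = g q \<longleftrightarrow>
      stacked_rank S L J q = (\<Sum>j\<in>{1..S}. query_rank L J (q j)) \<and>
      (\<forall>j\<in>{1..S}. stacked_rank S L (J - {m}) q = query_rank L (J - {m}) (q j)))"
    if q: "q \<in> possible_queries \<Omega> S Q m" for q
  proof -
    interpret query_family M S L q using m q by (rule query_family_possible)
    let ?R = "stacked_rank S L (J - {m}) q"
    have J': "J - {m} \<subseteq> {1..M}" using J by blast
    have dec: "stacked_rank S L J q = L + ?R"
      using decodes_possible[OF cor m q] J by (rule stacked_rank_eq_decoded)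
    have le: "?r (J - {m}) q j \<le> ?R" if "j \<in> {1..S}" for j
      using query_rank_le_stacked_rank[OF J' that] by simp
    have sum_le: "(\<Sum>j\<in>{1..S}. ?r (J - {m}) q j) \<le> S * ?R"
      using sum_bounded_above[of "{1..S}", OF le] by simp
    have "(\<Sum>j\<in>{1..S}. ?R - ?r (J - {m}) q j) = 0 \<longleftrightarrow> (\<forall>j\<in>{1..S}. ?R - ?r (J - {m}) q j = 0)"
      using le by (intro sum_nonneg_eq_0_iff) auto
    then have sum_eq: "(\<Sum>j\<in>{1..S}. ?r (J - {m}) q j) = S * ?R \<longleftrightarrow>
        (\<forall>j\<in>{1..S}. ?R = query_rank L (J - {m}) (q j))"
      by (auto simp: sum_subtractf)
    have div: "a / real S \<le> b \<longleftrightarrow> a \<le> real S * b" "a / real S = b \<longleftrightarrow> a = real S * b" for a b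
      using S by (auto simp: field_simps)
    have f: "f q \<le> real (L + ?R)" "f q = real (L + ?R) \<longleftrightarrow> (\<Sum>j\<in>{1..S}. ?r (J - {m}) q j) = S * ?R"
      using sum_le unfolding f_def of_nat_add add_le_cancel_left add_left_cancel div by (simp, simp)
    have "stacked_rank S L J q \<le> (\<Sum>j\<in>{1..S}. query_rank L J (q j))"
      using J(1) by (rule stacked_rank_le_sum)
    then have g: "real (L + ?R) \<le> g q"
        "real (L + ?R) = g q \<longleftrightarrow> stacked_rank S L J q = (\<Sum>j\<in>{1..S}. query_rank L J (q j))"
      unfolding g_def dec of_nat_sum[symmetric] of_nat_le_iff of_nat_eq_iff by - (assumption, rule refl)
    have eq: "f q = g q \<longleftrightarrow> f q = real (L + ?R) \<and> real (L + ?R) = g q"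
      using f(1) g(1) by linarith
    show ?thesis unfolding eq f(2) g(2) sum_eq using order_trans[OF f(1) g(1)] by blast
  qed
  have restr: "f (restrict q {1..S}) = f q" "g (restrict q {1..S}) = g q" for q
    by (simp_all add: f_def g_def)
  have le: "f y \<le> g y" if "prob (queries m -` {y} \<inter> space \<Omega>) > 0" for y
  proof -
    have "(\<forall>y. prob (queries m -` {y} \<inter> space \<Omega>) > 0 \<longrightarrow> f y \<le> g y) \<longleftrightarrow>
        (\<forall>q\<in>possible_queries \<Omega> S Q m. f q \<le> g q)"
      by (rule all_possible_queries_iff) (simp only: restr)
    then show ?thesis using bounds that by blast
  qed
  show "real L + total_rank m (J - {m}) / S \<le> total_rank m J"
    unfolding Ef Eg using sQ le by (rule expectation_simple_mono)
  show "real L + total_rank m (J - {m}) / S = total_rank m J \<longleftrightarrow> tight m J"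
  proof -
    have "(\<forall>y. prob (queries m -` {y} \<inter> space \<Omega>) > 0 \<longrightarrow> f y = g y) \<longleftrightarrow>
        (\<forall>q\<in>possible_queries \<Omega> S Q m. f q = g q)"
      by (rule all_possible_queries_iff) (simp only: restr)
    also have "\<dots> \<longleftrightarrow> tight m J"
      unfolding tight_def using bounds by (intro ball_cong refl) blast
    finally have "(\<forall>y. prob (queries m -` {y} \<inter> space \<Omega>) > 0 \<longrightarrow> f y = g y) \<longleftrightarrow> tight m J" .
    with expectation_simple_mono(2)[where f = f and g = g, OF sQ le]
    show ?thesis unfolding Ef Eg by (rule trans)
  qed
qed

lemma total_rank_capacity_iff:
  assumes S: "S \<ge> 1" and cor: "pir_correct \<Omega> M S L W Q" and priv: "pir_private \<Omega> M S Q"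
    and m: "m \<in> {1..M}"
  shows "total_rank m {1..M} \<ge> geometric_total L S M"
    and "total_rank m {1..M} = geometric_total L S M \<longleftrightarrow> (\<forall>J\<subseteq>{1..M}. \<forall>k\<in>J. tight k J)"
proof -
  have D: "total_rank m J = total_rank k J" if "k \<in> {1..M}" for k J
    using priv m that by (rule total_rank_private)
  \<comment> \<open>The step that removes \<open>k\<close> needs \<open>k\<close> to be decodable,
    so it is taken with wanted message \<open>k\<close>; privacy carries it over to the fixed
    \<open>m\<close>.\<close>
  have step: "total_rank m J \<ge> real L + total_rank m (J - {k}) / S" if "J \<subseteq> {1..M}" "k \<in> J" for J k
    using total_rank_step(1)[OF S cor that] D[of k] that by auto
  have s: "real S > 0" using S by simp
  show "total_rank m {1..M} \<ge> geometric_total L S M"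
    using recursive_bound[where D = "total_rank m",
        OF finite_atLeastAtMost[of 1 M] s total_rank_empty[OF m] step order.refl] by simp
  have "total_rank m {1..M} = geometric_total L S M \<longleftrightarrow>
      (\<forall>J\<subseteq>{1..M}. \<forall>k\<in>J. real L + total_rank m (J - {k}) / S = total_rank m J)"
    using recursive_bound_tight_iff[where D = "total_rank m",
        OF finite_atLeastAtMost[of 1 M] s total_rank_empty[OF m] step] by simp
  also have "\<dots> \<longleftrightarrow> (\<forall>J\<subseteq>{1..M}. \<forall>k\<in>J. tight k J)"
  proof (intro all_cong ball_cong refl)
    fix J k assume "J \<subseteq> {1..M}" "k \<in> J"
    then show "real L + total_rank m (J - {k}) / S = total_rank m J \<longleftrightarrow> tight k J"
      using total_rank_step(2)[OF S cor, of J k] D[of k] by (metis subsetD)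
  qed
  finally show "total_rank m {1..M} = geometric_total L S M \<longleftrightarrow> (\<forall>J\<subseteq>{1..M}. \<forall>k\<in>J. tight k J)" .
qed

lemma pir_rate_eq:
  assumes M: "M \<ge> 1" and priv: "pir_private \<Omega> M S Q"
  shows "pir_rate \<Omega> M S L W Q = L / total_rank 1 {1..M}"
proof -
  have "entropy_of CARD('a) \<Omega> (W m) /
      (\<Sum>i\<in>{1..S}. cond_entropy_of CARD('a) \<Omega> (pir_response M L W Q m i) (Q m i)) =
      L / total_rank 1 {1..M}" if m: "m \<in> {1..M}" for m
  proof -
    have "(\<Sum>i\<in>{1..S}. cond_entropy_of CARD('a) \<Omega> (pir_response M L W Q m i) (Q m i)) =
        total_rank m {1..M}"
      unfolding total_rank_def by (intro sum.cong refl cond_entropy_response[OF m])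
    also have "\<dots> = total_rank 1 {1..M}" using priv m M by (intro total_rank_private) auto
    finally show ?thesis using entropy_message[OF M m] by simp
  qed
  then have "(\<lambda>m. entropy_of CARD('a) \<Omega> (W m) /
      (\<Sum>i\<in>{1..S}. cond_entropy_of CARD('a) \<Omega> (pir_response M L W Q m i) (Q m i))) ` {1..M} =
      {L / total_rank 1 {1..M}}"
    using M by (intro equalityI subsetI) (auto simp: image_iff intro: bexI[of _ 1])
  then show ?thesis by (simp add: pir_rate_def)
qed

text \<open>As \<open>Ibar\<close> runs through the subsets of \<open>{1..M} - {m}\<close>, its
  complement runs through the sets \<open>J\<close> that contain \<open>m\<close>, so the second
  condition is one half of tightness. The first condition is the other half at
  \<open>J = {1..M}\<close> and passes down to smaller sets.\<close>

lemma all_tight_iff: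
  "(\<forall>J\<subseteq>{1..M}. \<forall>m\<in>J. tight m J) \<longleftrightarrow>
    (\<forall>m\<in>{1..M}. \<forall>q\<in>possible_queries \<Omega> S Q m. \<forall>j\<in>{1..S}.
       stacked_rank S L ({1..M} - {m}) q = query_rank L ({1..M} - {m}) (q j)) \<and>
    (\<forall>m\<in>{1..M}. \<forall>q\<in>possible_queries \<Omega> S Q m. \<forall>Ibar. Ibar \<subseteq> {1..M} - {m} \<longrightarrow>
       (let I = {1..M} - Ibar in
        stacked_rank S L I q = (\<Sum>j\<in>{1..S}. query_rank L I (q j))))" (is "?T \<longleftrightarrow> ?A \<and> ?B")
proof (intro iffI conjI)
  assume ?T
  then show ?A unfolding tight_def by blast
  show ?B unfolding Let_def
  proof (intro ballI allI impI)
    fix m q Ibar assume "m \<in> {1..M}" "q \<in> possible_queries \<Omega> S Q m" "Ibar \<subseteq> {1..M} - {m}"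
    moreover from this have "tight m ({1..M} - Ibar)" using \<open>?T\<close> by blast
    ultimately show "stacked_rank S L ({1..M} - Ibar) q =
        (\<Sum>j\<in>{1..S}. query_rank L ({1..M} - Ibar) (q j))"
      unfolding tight_def by blast
  qed
next
  assume AB: "?A \<and> ?B"
  show ?T unfolding tight_def
  proof (intro allI impI ballI conjI)
    fix J m q assume J: "J \<subseteq> {1..M}" "m \<in> J" and q: "q \<in> possible_queries \<Omega> S Q m"
    then have m: "m \<in> {1..M}" by blast
    have "{1..M} - ({1..M} - J) = J" "{1..M} - J \<subseteq> {1..M} - {m}" using J by auto
    then show "stacked_rank S L J q = (\<Sum>j\<in>{1..S}. query_rank L J (q j))"
      using AB m q unfolding Let_def by metis
    fix j assume j: "j \<in> {1..S}"
    interpret query_family M S L q using m q by (rule query_family_possible)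
    have "query_rank L ({1..M} - {m}) (q j) = stacked_rank S L ({1..M} - {m}) q"
      using AB m q j by metis
    then show "stacked_rank S L (J - {m}) q = query_rank L (J - {m}) (q j)"
      using J j by (intro query_rank_eq_stacked_rank_subset[symmetric, of "{1..M} - {m}"]) auto
  qed
qed

end

text \<open>By the geometric sum the capacity is \<open>l / geometric_total l s n\<close>. The lower
  bound makes \<open>d\<close> positive, so the two quotients agree only if their denominators
  do.\<close>

lemma rate_eq_capacity_iff:
  fixes l d :: real and s n :: nat
  assumes "s \<ge> 2" "n \<ge> 1" "l > 0" and d: "d \<ge> geometric_total l s n"
  shows "l / d = (1 - 1 / real s) / (1 - (1 / real s) ^ n) \<longleftrightarrow> d = geometric_total l s n"
proof -
  let ?x = "1 / real s"
  have x: "0 < ?x" "?x < 1" using assms(1) by auto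
  then have xn: "?x ^ n < 1" using x assms(2) power_less_one_iff[of ?x n] by linarith
  have sum: "(\<Sum>i<n. ?x ^ i) = (1 - ?x ^ n) / (1 - ?x)"
    using sum_gp_strict[of ?x n] x by auto
  have G: "geometric_total l s n = l * ((1 - ?x ^ n) / (1 - ?x))"
    unfolding geometric_total_def sum ..
  have "geometric_total l s n > 0" unfolding G using x xn assms(3) by simp
  then have "d > 0" using d by linarith
  then show ?thesis unfolding G using x xn assms(3) by (auto simp: field_simps)
qed

theorem mainTheorem4:
  fixes \<Omega> :: "'w measure"
    and M S L :: nat
    and W :: "nat \<Rightarrow> 'w \<Rightarrow> 'a::{field,finite} Matrix.vec"
    and Q :: "nat \<Rightarrow> nat \<Rightarrow> 'w \<Rightarrow> 'a mat"
  assumes "M \<ge> 2" and "S \<ge> 2"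
    and "linear_pir_scheme \<Omega> M S L W Q"
    and "pir_correct \<Omega> M S L W Q"
    and "pir_private \<Omega> M S Q"
  shows "pir_rate \<Omega> M S L W Q = (1 - 1 / real S) / (1 - (1 / real S) ^ M) \<longleftrightarrow>
    (\<forall>m\<in>{1..M}. \<forall>q\<in>possible_queries \<Omega> S Q m. \<forall>j\<in>{1..S}.
       mat_rank (stacked_query_part S L ({1..M} - {m}) q) =
       mat_rank (query_part L ({1..M} - {m}) (q j))) \<and>
    (\<forall>m\<in>{1..M}. \<forall>q\<in>possible_queries \<Omega> S Q m. \<forall>Ibar. Ibar \<subseteq> {1..M} - {m} \<longrightarrow>
       (let I = {1..M} - Ibar in
        mat_rank (stacked_query_part S L I q) =
        (\<Sum>j\<in>{1..S}. mat_rank (query_part L I (q j)))))"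
proof -
  interpret linear_pir_scheme \<Omega> M S L W Q by fact
  have MS: "M \<ge> 1" "S \<ge> 1" "1 \<in> {1..M}" using assms(1,2) by auto
  have "pir_rate \<Omega> M S L W Q = (1 - 1 / real S) / (1 - (1 / real S) ^ M) \<longleftrightarrow>
      total_rank 1 {1..M} = geometric_total L S M"
    unfolding pir_rate_eq[OF MS(1) assms(5)]
    using message_length_pos total_rank_capacity_iff(1)[OF MS(2) assms(4,5) MS(3)]
    by (intro rate_eq_capacity_iff assms(2) MS(1)) auto
  also have "\<dots> \<longleftrightarrow> (\<forall>J\<subseteq>{1..M}. \<forall>m\<in>J. tight m J)"
    by (rule total_rank_capacity_iff(2)[OF MS(2) assms(4,5) MS(3)])
  finally show ?thesis
    unfolding all_tight_iff stacked_rank_def query_rank_def .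
qed

end
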